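(* Let $p\ge 3$ be any prime. Then for all nonnegative integers $n$ and $\alpha$ the following hold. (1) If $n$ is not a triangular number (i.e. not of the form $k(k+1)/2$ with $k\ge0$ an integer), then $$v_0(p^{2\alpha}\, 9^{2}(32n+4))\equiv 0\pmod{27}.$$ (2) For every $i\in\{1,2,3,\ldots,p-1\}$, $$v_0(p^{2\alpha+1}\, 9^{2}(32pn+32i+4p))\equiv 0\pmod{27}.$$ (3) For every integer $j\ge 0$ such that $8j+1$ is a quadratic nonresidue modulo $p$, $$v_0(p^{2\alpha}\, 9^{2}(32pn+32j+4))\equiv 0\pmod{27}.$$
   Context: The integer sequence $v_0(n)$, $n\ge 0$, is defined by the generating function (formal power series in $q$) $$\sum_{n=0}^\infty v_0(n)q^n=\sum_{n=0}^\infty \frac{q^{n^2}(-q;q^2)_n}{(q;q^2)_n},$$ where $(a;q)_0=1$ and $(a;q)_n=\prod_{i=1}^n(1-aq^{i-1})$ for $n\ge1$, so that $(-q;q^2)_n=\prod_{i=1}^n(1+q^{2i-1})$ and $(q;q^2)_n=\prod_{i=1}^n(1-q^{2i-1})$. *)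

theory Defs
  imports
    "HOL-Number_Theory.Number_Theory"
    "HOL-Computational_Algebra.Formal_Power_Series"
begin

definition q_pochhammer :: "'a::comm_ring_1 \<Rightarrow> 'a \<Rightarrow> nat \<Rightarrow> 'a"
  where "q_pochhammer a q n = (\<Prod>i = 1..n. 1 - a * q ^ (i - 1))"

(* int is not of class inverse, so "/" is not available on int fps.  All denominators below have
   constant term 1, and fps_right_inverse D 1 is then the genuine inverse of D
   (see v0_denominator_inverse). *)
definition v0_term :: "nat \<Rightarrow> int fps"
  where "v0_term n = fps_X ^ (n\<^sup>2) * q_pochhammer (- fps_X) (fps_X\<^sup>2) n *
           fps_right_inverse (q_pochhammer fps_X (fps_X\<^sup>2) n) 1"

(* The sum converges in the X-adic topology on power series (see summable_v0_term), so suminf is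
   not applied to a divergent series. *)
definition v0 :: "nat \<Rightarrow> int"
  where "v0 n = fps_nth (\<Sum>k. v0_term k) n"

definition triangular :: "nat \<Rightarrow> bool"
  where "triangular n \<longleftrightarrow> (\<exists>k::nat. n = k * (k + 1) div 2)"

lemma v0_denominator_nth_0: "fps_nth (q_pochhammer fps_X (fps_X\<^sup>2) n :: int fps) 0 = 1"
  by (induction n) (simp_all add: q_pochhammer_def)

lemma v0_denominator_inverse:
  "q_pochhammer fps_X (fps_X\<^sup>2) n *
     fps_right_inverse (q_pochhammer fps_X (fps_X\<^sup>2) n) 1 = (1 :: int fps)"
  by (rule fps_right_inverse) (simp add: v0_denominator_nth_0)

lemma v0_term_nth_eq_0: "m < n\<^sup>2 \<Longrightarrow> fps_nth (v0_term n) m = 0"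
  by (simp add: v0_term_def mult.assoc fps_X_power_mult_nth)

lemma v0_term_sums: "v0_term sums Abs_fps (\<lambda>m. \<Sum>k\<le>m. fps_nth (v0_term k) m)"
  unfolding sums_def
proof (rule tendsto_fpsI)
  fix m
  show "\<forall>\<^sub>F N in sequentially. fps_nth (\<Sum>k<N. v0_term k) m =
          fps_nth (Abs_fps (\<lambda>m. \<Sum>k\<le>m. fps_nth (v0_term k) m)) m"
    using eventually_gt_at_top[of m]
  proof eventually_elim
    case (elim N)
    have "fps_nth (v0_term k) m = 0" if "k \<in> {..<N} - {..m}" for k
    proof (rule v0_term_nth_eq_0)
      have "m < k" using that by auto
      also have "k \<le> k\<^sup>2" by (simp add: power2_eq_square)
      finally show "m < k\<^sup>2" .
    qed
    then have "(\<Sum>k<N. fps_nth (v0_term k) m) = (\<Sum>k\<le>m. fps_nth (v0_term k) m)"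
      using elim by (intro sum.mono_neutral_right) auto
    then show ?case by (simp add: fps_sum_nth)
  qed
qed

lemma summable_v0_term: "summable v0_term"
  using v0_term_sums by (rule sums_summable)

lemma v0_eq_sum: "v0 n = (\<Sum>k\<le>n. fps_nth (v0_term k) n)"
  by (simp add: v0_def sums_unique[OF v0_term_sums, symmetric])

end

theory Submission
  imports Defs
begin

text \<open>
  Write \<open>W(q)\<close> for the generating function of \<open>v0\<close>, \<open>\<phi>(q) = \<Sum> q^(n^2)\<close>, \<open>\<psi>(q) = \<Sum> q^(n(n+1)/2)\<close> and \<open>E\<close>
  for Euler's product. Extended to all integers \<open>n\<close>, the defining sum becomes \<open>W(q) + W(-q) - 1\<close>.
  Deform it to
  \<open>F(g) = \<Sum> q^(n^2) \<Prod>i<n. (g + q^(2i+1)) / (1 - g q^(2i+1))\<close>; telescoping gives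
  \<open>(1 - g^2 q^2) F(g) = (1 + g^2 q^2) F(g q^2)\<close>, and iterating down to \<open>F(0) = \<phi>(q^2)\<close> evaluates the even
  part of \<open>W\<close> as a product. Dissecting \<open>\<phi>\<close> repeatedly by parity then gives
  \<open>\<Sum> 2 v0(32n+4) q^n = 6 \<psi>(q) + 1024 q \<psi>(q)^9 / \<phi>(-q)^8\<close>.

  By \<open>E^3 = \<psi>(q) \<phi>(-q)^2\<close>, the quotient \<open>\<psi>^9 / \<phi>(-q)^8\<close> is \<open>\<phi>(-q) (E(q^2) / E(q))^27\<close>.
  Jacobi's series for \<open>E^3\<close> splits as \<open>P(q^3) - 3 q E(q^9)^3\<close>, and \<open>P\<close> is congruent to
  \<open>E + 3 q E'\<close> modulo 9 by comparing pentagonal series term by term. Extracting every ninth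
  coefficient of the quotient therefore leaves \<open>\<psi> + 9 q \<psi>'\<close> modulo 27. So \<open>v0(324 N)\<close> with
  \<open>N = 1\<close> modulo 8 vanishes modulo 27 unless \<open>N\<close> is a square, and in all three cases \<open>N\<close> is not one.
\<close>

subsection \<open>The topology of integer power series\<close>

text \<open>The telescoping leaves a boundary term that is odd in g; it cancels only against its
  counterpart at -g, which is why the two-sided sum is treated and the even part of W comes out as a
  product. Integer power series have no general division, so identities are stated with denominators
  cleared, and factors are cancelled because they are nonzero or have constant term 1. The modulus
  27 is reached by cubing: x = y modulo d with 3 dividing d gives x^3 = y^3 modulo 3d. From E^3 =
  P(q^3) modulo 3 follows E^27 = P(q^3)^9 modulo 27, so the first extraction of every third
  coefficient meets only series in q^3 besides \<phi>(-q). It leaves E^9, which is P(q^3)^3 only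
  modulo 9. The correction terms have exponents prime to 3, so the second extraction removes them
  once they are tracked exactly. What remains is P^3, and this is why P has to be known modulo 9.
  Finally, the operator q d/dq does not enlarge the support of a series, so \<psi> and its
  derivative vanish at the same indices.\<close>

lemma fps_X_power_dvd_iff:
  fixes f :: "'a::comm_ring_1 fps"
  shows "fps_X ^ k dvd f \<longleftrightarrow> (\<forall>i<k. fps_nth f i = 0)"
proof
  assume "fps_X ^ k dvd f"
  then obtain g where "f = fps_X ^ k * g" by (elim dvdE)
  then show "\<forall>i<k. fps_nth f i = 0" by (simp add: fps_X_power_mult_nth)
next
  assume *: "\<forall>i<k. fps_nth f i = 0"
  have "f = fps_X ^ k * Abs_fps (\<lambda>n. fps_nth f (n + k))"
    using * by (simp add: fps_eq_iff fps_X_power_mult_nth)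
  then show "fps_X ^ k dvd f" by (rule dvdI)
qed

text \<open>Convergence becomes divisibility of the error by powers of X, so that limits of products
  and the removal of small errors are ring manipulations.\<close>

lemma fps_tendsto_iff_dvd:
  fixes f :: "nat \<Rightarrow> int fps"
  shows "f \<longlonglongrightarrow> F \<longleftrightarrow> (\<forall>k. \<forall>\<^sub>F n in sequentially. fps_X ^ k dvd f n - F)"
proof
  assume "f \<longlonglongrightarrow> F"
  then have "\<forall>n. \<forall>\<^sub>F x in sequentially. fps_nth (f x) n = fps_nth F n"
    by (simp add: tendsto_fps_iff)
  then have "\<forall>\<^sub>F x in sequentially. \<forall>n\<in>{..<k}. fps_nth (f x) n = fps_nth F n" for k
    by (subst eventually_ball_finite_distrib) auto
  then show "\<forall>k. \<forall>\<^sub>F n in sequentially. fps_X ^ k dvd f n - F"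
    unfolding fps_X_power_dvd_iff by (simp add: Ball_def)
next
  assume *: "\<forall>k. \<forall>\<^sub>F n in sequentially. fps_X ^ k dvd f n - F"
  show "f \<longlonglongrightarrow> F"
  proof (rule tendsto_fpsI)
    fix n
    show "\<forall>\<^sub>F x in sequentially. fps_nth (f x) n = fps_nth F n"
      using *[rule_format, of "Suc n"]
      by eventually_elim (simp add: fps_X_power_dvd_iff del: power_Suc)
  qed
qed

lemma fps_tendsto_mult:
  fixes f g :: "nat \<Rightarrow> int fps"
  assumes "f \<longlonglongrightarrow> F" "g \<longlonglongrightarrow> G"
  shows "(\<lambda>n. f n * g n) \<longlonglongrightarrow> F * G"
  unfolding fps_tendsto_iff_dvd
proof
  fix k
  have "\<forall>\<^sub>F n in sequentially. fps_X ^ k dvd f n - F" "\<forall>\<^sub>F n in sequentially. fps_X ^ k dvd g n - G"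
    using assms by (simp_all add: fps_tendsto_iff_dvd)
  then show "\<forall>\<^sub>F n in sequentially. fps_X ^ k dvd f n * g n - F * G"
  proof eventually_elim
    case (elim n)
    have "f n * g n - F * G = (f n - F) * g n + F * (g n - G)" by (simp add: algebra_simps)
    then show ?case using elim by (metis dvd_add dvd_mult dvd_mult2)
  qed
qed

lemma fps_tendsto_add:
  fixes f g :: "nat \<Rightarrow> int fps"
  assumes "f \<longlonglongrightarrow> F" "g \<longlonglongrightarrow> G"
  shows "(\<lambda>n. f n + g n) \<longlonglongrightarrow> F + G"
  unfolding tendsto_fps_iff
proof
  fix n
  have "\<forall>\<^sub>F x in sequentially. fps_nth (f x) n = fps_nth F n" "\<forall>\<^sub>F x in sequentially. fps_nth (g x) n = fps_nth G n"
    using assms by (simp_all add: tendsto_fps_iff)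
  then show "\<forall>\<^sub>F x in sequentially. fps_nth (f x + g x) n = fps_nth (F + G) n"
    by eventually_elim simp
qed

text \<open>This is how finite identities pass to the limit: an error divisible by X^n at stage
  \<open>n\<close> is harmless. The triple product estimates aim at exactly this precision.\<close>

lemma fps_tendsto_cong_dvd:
  fixes f g :: "nat \<Rightarrow> int fps"
  assumes "f \<longlonglongrightarrow> F" and "\<And>n. fps_X ^ n dvd g n - f n"
  shows "g \<longlonglongrightarrow> F"
  unfolding fps_tendsto_iff_dvd
proof
  fix k
  have "\<forall>\<^sub>F n in sequentially. fps_X ^ k dvd f n - F"
    using assms(1) by (simp add: fps_tendsto_iff_dvd)
  then show "\<forall>\<^sub>F n in sequentially. fps_X ^ k dvd g n - F"
    using eventually_ge_at_top[of k]
  proof eventually_elim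
    case (elim n)
    then have "fps_X ^ k dvd g n - f n" by (meson assms(2) dvd_trans le_imp_power_dvd)
    then have "fps_X ^ k dvd (g n - f n) + (f n - F)" using elim(1) by (rule dvd_add)
    then show ?case by simp
  qed
qed

lemma fps_const_term_1_unit:
  fixes f :: "int fps"
  assumes "fps_nth f 0 = 1"
  obtains g where "f * g = 1" "fps_nth g 0 = 1"
proof
  show "f * fps_right_inverse f 1 = 1" by (rule fps_right_inverse) (simp add: assms)
  then show "fps_nth (fps_right_inverse f 1) 0 = 1"
    by (metis assms fps_mult_nth_0 fps_one_nth mult_1)
qed

text \<open>Constant term 1 makes a series a unit over the integers. This replaces division inside
  congruences, where having no zero divisors would not suffice.\<close>

lemma dvd_mult_cancel_const_term_1:
  fixes f :: "int fps"
  assumes "fps_nth f 0 = 1" "c dvd f * g"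
  shows "c dvd g"
proof -
  obtain h where h: "f * h = 1" using assms(1) by (rule fps_const_term_1_unit)
  have "g = h * (f * g)" using h by (metis mult.assoc mult.commute mult_1)
  then show ?thesis using assms(2) by (metis dvd_mult)
qed

subsection \<open>Infinite products\<close>

text \<open>Coefficient n is read off the product up to factor n. This agrees with the infinite
  product when factor i is 1 modulo X^(i+1), since later factors then leave coefficient n
  unchanged.\<close>

definition fps_infprod :: "(nat \<Rightarrow> int fps) \<Rightarrow> int fps"
  where "fps_infprod f = Abs_fps (\<lambda>n. fps_nth (\<Prod>i\<le>n. f i) n)"

lemma fps_infprod_tendsto:
  assumes "\<And>i. fps_X ^ Suc i dvd f i - 1"
  shows "(\<lambda>N. \<Prod>i<N. f i) \<longlonglongrightarrow> fps_infprod f"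
proof (rule tendsto_fpsI)
  fix n
  have stable: "fps_X ^ Suc n dvd (\<Prod>i<Suc n + m. f i) - (\<Prod>i<Suc n. f i)" for m
  proof (induction m)
    case (Suc m)
    have "fps_X ^ Suc n dvd f (Suc n + m) - 1"
      using assms[of "Suc n + m"] by (rule dvd_trans[rotated]) (simp add: le_imp_power_dvd del: power_Suc)
    then have "fps_X ^ Suc n dvd (\<Prod>i<Suc n + m. f i) * (f (Suc n + m) - 1) +
        ((\<Prod>i<Suc n + m. f i) - (\<Prod>i<Suc n. f i))"
      by (intro dvd_add dvd_mult Suc)
    then show ?case by (simp add: algebra_simps)
  qed simp
  have *: "fps_nth (\<Prod>i<N. f i) n = fps_nth (fps_infprod f) n" if "N > n" for N
    using stable[of "N - Suc n"] that
    by (simp add: fps_X_power_dvd_iff fps_infprod_def lessThan_Suc_atMost del: power_Suc prod.lessThan_Suc)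
  show "\<forall>\<^sub>F N in sequentially. fps_nth (\<Prod>i<N. f i) n = fps_nth (fps_infprod f) n"
    by (rule eventually_mono[OF eventually_gt_at_top[of n]]) (rule *)
qed

lemma fps_infprod_nth_0: 
  assumes "\<And>i. fps_nth (f i) 0 = 1"
  shows "fps_nth (fps_infprod f) 0 = 1"
  using assms by (simp add: fps_infprod_def)

subsection \<open>Dilations and sections\<close>

definition fps_dilate :: "nat \<Rightarrow> int fps \<Rightarrow> int fps"
  where "fps_dilate k f = f oo fps_X ^ k"

lemma fps_dilate_nth:
  assumes "k > 0"
  shows "fps_nth (fps_dilate k f) n = (if k dvd n then fps_nth f (n div k) else 0)"
proof -
  have "fps_nth (fps_dilate k f) n = (\<Sum>i = 0..n. if n = k * i then fps_nth f i else 0)"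
    unfolding fps_dilate_def fps_compose_nth power_mult[symmetric]
    by (intro sum.cong) auto
  also have "\<dots> = (if k dvd n then fps_nth f (n div k) else 0)"
  proof (cases "k dvd n")
    case True
    then obtain m where m: "n = k * m" by blast
    have "(\<Sum>i = 0..n. if n = k * i then fps_nth f i else 0) = (\<Sum>i = 0..n. if i = m then fps_nth f i else 0)"
      using assms m by (intro sum.cong) auto
    then show ?thesis using assms m by simp
  next
    case False
    then show ?thesis by (auto intro!: sum.neutral)
  qed
  finally show ?thesis .
qed

context
  fixes k :: nat
  assumes k: "k > 0"
begin

lemma fps_dilate_mult: "fps_dilate k (f * g) = fps_dilate k f * fps_dilate k g"
  unfolding fps_dilate_def by (rule fps_compose_mult_distrib) (use k in simp)

lemma fps_dilate_power: "fps_dilate k (f ^ m) = fps_dilate k f ^ m"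
  unfolding fps_dilate_def by (rule fps_compose_power[symmetric]) (use k in simp)

lemma fps_dilate_X: "fps_dilate k fps_X = fps_X ^ k"
  unfolding fps_dilate_def by (rule fps_X_fps_compose_startby0) (use k in simp)

lemma fps_dilate_prod: "fps_dilate k (\<Prod>i\<in>A. f i) = (\<Prod>i\<in>A. fps_dilate k (f i))"
  unfolding fps_dilate_def by (rule fps_compose_prod_distrib) (use k in simp)

end

lemma fps_dilate_1: "fps_dilate k 1 = 1"
  and fps_dilate_numeral: "fps_dilate k (numeral m) = numeral m"
  and fps_dilate_add: "fps_dilate k (f + g) = fps_dilate k f + fps_dilate k g"
  and fps_dilate_diff: "fps_dilate k (f - g) = fps_dilate k f - fps_dilate k g"
  and fps_dilate_uminus: "fps_dilate k (- f) = - fps_dilate k f"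
  by (simp_all add: fps_dilate_def fps_compose_add_distrib fps_compose_sub_distrib fps_compose_uminus)

lemmas fps_dilate_simps = fps_dilate_1 fps_dilate_numeral fps_dilate_add fps_dilate_diff
  fps_dilate_uminus fps_dilate_mult fps_dilate_power fps_dilate_X fps_dilate_prod

lemma fps_dilate_nth_0 [simp]: "fps_nth (fps_dilate k f) 0 = fps_nth f 0"
  by (simp add: fps_dilate_def)

lemma fps_dilate_dilate:
  assumes "k > 0" "l > 0"
  shows "fps_dilate k (fps_dilate l f) = fps_dilate (k * l) f"
proof -
  have "fps_dilate k (fps_dilate l f) = f oo (fps_X ^ l oo fps_X ^ k)"
    unfolding fps_dilate_def by (rule fps_compose_assoc[symmetric]) (use assms in auto)
  also have "fps_X ^ l oo fps_X ^ k = (fps_X ^ (k * l) :: int fps)"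
    using assms by (simp add: fps_X_power_compose power_mult)
  finally show ?thesis by (simp add: fps_dilate_def)
qed

lemma fps_dilate_numeral_dilate [simp]:
  "fps_dilate (numeral k) (fps_dilate (numeral l) f) = fps_dilate (numeral k * numeral l) f"
  by (rule fps_dilate_dilate) auto

lemma fps_dilate_tendsto:
  assumes "f \<longlonglongrightarrow> F" "k > 0"
  shows "(\<lambda>n. fps_dilate k (f n)) \<longlonglongrightarrow> fps_dilate k F"
  using assms by (auto simp: tendsto_fps_iff fps_dilate_nth)

definition fps_section :: "nat \<Rightarrow> nat \<Rightarrow> int fps \<Rightarrow> int fps"
  where "fps_section k r f = Abs_fps (\<lambda>n. fps_nth f (k * n + r))"

lemma fps_section_nth [simp]: "fps_nth (fps_section k r f) n = fps_nth f (k * n + r)"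
  by (simp add: fps_section_def)

lemma fps_section_add: "fps_section k r (f + g) = fps_section k r f + fps_section k r g"
  and fps_section_diff: "fps_section k r (f - g) = fps_section k r f - fps_section k r g"
  and fps_section_uminus: "fps_section k r (- f) = - fps_section k r f"
  and fps_section_numeral_mult: "fps_section k r (numeral m * f) = numeral m * fps_section k r f"
  by (simp_all add: fps_eq_iff numeral_fps_const)

text \<open>In the convolution only indices divisible by \<open>k\<close> contribute, so a factor in
  q^k passes through the extraction of a residue class. The later dissections first arrange their
  denominators to be of this kind.\<close>

lemma fps_section_dilate_mult:
  assumes "r < k"
  shows "fps_section k r (fps_dilate k f * g) = f * fps_section k r g"
proof (rule fps_ext)
  fix n
  have k: "k > 0" using assms by simp
  have "fps_nth (fps_section k r (fps_dilate k f * g)) n =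
      (\<Sum>i = 0..k * n + r. fps_nth (fps_dilate k f) i * fps_nth g (k * n + r - i))"
    by (simp add: fps_mult_nth)
  also have "\<dots> = (\<Sum>i\<in>(*) k ` {0..n}. fps_nth (fps_dilate k f) i * fps_nth g (k * n + r - i))"
  proof (rule sum.mono_neutral_right)
    show "(*) k ` {0..n} \<subseteq> {0..k * n + r}" by (auto intro!: trans_le_add1)
    show "\<forall>i\<in>{0..k * n + r} - (*) k ` {0..n}. fps_nth (fps_dilate k f) i * fps_nth g (k * n + r - i) = 0"
    proof
      fix i assume i: "i \<in> {0..k * n + r} - (*) k ` {0..n}"
      have "\<not> k dvd i"
      proof
        assume "k dvd i"
        then obtain m where m: "i = k * m" by blast
        have "k * m < k * (n + 1)" using i m assms by auto
        then have "m \<le> n" by (metis Suc_eq_plus1 less_Suc_eq_le mult_less_cancel1)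
        then show False using i m by auto
      qed
      then show "fps_nth (fps_dilate k f) i * fps_nth g (k * n + r - i) = 0"
        using k by (simp add: fps_dilate_nth)
    qed
  qed simp
  also have "\<dots> = (\<Sum>i = 0..n. fps_nth f i * fps_nth g (k * n + r - k * i))"
    using k by (subst sum.reindex) (auto simp: inj_on_def fps_dilate_nth)
  also have "\<dots> = (\<Sum>i = 0..n. fps_nth f i * fps_nth (fps_section k r g) (n - i))"
  proof (rule sum.cong)
    fix i assume "i \<in> {0..n}"
    then have "k * n + r - k * i = k * (n - i) + r" by (simp add: diff_mult_distrib2)
    then show "fps_nth f i * fps_nth g (k * n + r - k * i) = fps_nth f i * fps_nth (fps_section k r g) (n - i)"
      by simp
  qed simp
  finally show "fps_nth (fps_section k r (fps_dilate k f * g)) n = fps_nth (f * fps_section k r g) n"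
    by (simp add: fps_mult_nth)
qed

lemma fps_section_X_power:
  assumes "r < k"
  shows "fps_section k r (fps_X ^ c) = (if c mod k = r then fps_X ^ (c div k) else 0)"
proof (rule fps_ext)
  fix n
  have "k * n + r = c \<longleftrightarrow> c mod k = r \<and> n = c div k" using assms by auto
  then show "fps_nth (fps_section k r (fps_X ^ c)) n = fps_nth (if c mod k = r then fps_X ^ (c div k) else 0) n"
    by auto
qed

lemma fps_section_dilate_X_power:
  assumes "r < k"
  shows "fps_section k r (fps_dilate k f * fps_X ^ c) = (if c mod k = r then f * fps_X ^ (c div k) else 0)"
  using assms by (simp add: fps_section_dilate_mult fps_section_X_power)

lemma fps_section_dilate:
  assumes "r < k"
  shows "fps_section k r (fps_dilate k f) = (if r = 0 then f else 0)"
  using fps_section_dilate_X_power[OF assms, of f 0] by simp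

lemma numeral_dvd_fps_iff: "(numeral m :: int fps) dvd f \<longleftrightarrow> (\<forall>n. numeral m dvd fps_nth f n)"
proof
  assume "\<forall>n. numeral m dvd fps_nth f n"
  then have "f = numeral m * Abs_fps (\<lambda>n. fps_nth f n div numeral m)"
    by (simp add: fps_eq_iff numeral_fps_const)
  then show "numeral m dvd f" by (rule dvdI)
qed (auto simp: numeral_fps_const elim!: dvdE)

lemma numeral_dvd_fps_section: "(numeral m :: int fps) dvd f \<Longrightarrow> numeral m dvd fps_section k r f"
  by (simp add: numeral_dvd_fps_iff)

lemma numeral_dvd_fps_dilate: "k > 0 \<Longrightarrow> (numeral m :: int fps) dvd f \<Longrightarrow> numeral m dvd fps_dilate k f"
  by (simp add: numeral_dvd_fps_iff fps_dilate_nth)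

subsection \<open>Series with prescribed exponents\<close>

text \<open>Terms are grouped by exponent over an arbitrary index type, so bilateral and double
  series can be rearranged through maps of the index. A sum over an infinite fibre is 0 by
  convention; lemmas that split or multiply series therefore assume finite fibres.\<close>

definition qseries :: "('a \<Rightarrow> int) \<Rightarrow> ('a \<Rightarrow> nat) \<Rightarrow> int fps"
  where "qseries c e = Abs_fps (\<lambda>n. \<Sum>k | e k = n. c k)"

lemma qseries_nth: "fps_nth (qseries c e) n = (\<Sum>k | e k = n. c k)"
  by (simp add: qseries_def)

lemma qseries_mult:
  assumes "\<And>n. finite {k. e k = n}" "\<And>n. finite {k. e' k = n}"
  shows "qseries c e * qseries c' e' = qseries (\<lambda>(k, l). c k * c' l) (\<lambda>(k, l). e k + e' l)"
proof (rule fps_ext)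
  fix n
  have "(\<Sum>kl | (case kl of (k, l) \<Rightarrow> e k + e' l) = n. case kl of (k, l) \<Rightarrow> c k * c' l) =
      (\<Sum>kl \<in> (\<Union>i\<in>{0..n}. {k. e k = i} \<times> {l. e' l = n - i}). case kl of (k, l) \<Rightarrow> c k * c' l)"
    by (intro sum.cong) auto
  also have "\<dots> = (\<Sum>i = 0..n. \<Sum>kl\<in>{k. e k = i} \<times> {l. e' l = n - i}. case kl of (k, l) \<Rightarrow> c k * c' l)"
    using assms by (intro sum.UNION_disjoint) auto
  also have "\<dots> = fps_nth (qseries c e * qseries c' e') n"
    by (simp add: fps_mult_nth qseries_nth sum_product sum.cartesian_product)
  finally show "fps_nth (qseries c e * qseries c' e') n =
      fps_nth (qseries (\<lambda>(k, l). c k * c' l) (\<lambda>(k, l). e k + e' l)) n"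
    by (simp add: qseries_nth)
qed

lemma qseries_reindex:
  assumes "bij h"
  shows "qseries c e = qseries (c \<circ> h) (e \<circ> h)"
proof (rule fps_ext)
  fix n
  have "(\<Sum>k | e (h k) = n. c (h k)) = (\<Sum>k\<in>h ` {k. e (h k) = n}. c k)"
    using assms by (subst sum.reindex) (auto simp: bij_def inj_on_def)
  also have "h ` {k. e (h k) = n} = {k. e k = n}"
    using assms by (auto simp: bij_def surj_def image_iff)
  finally show "fps_nth (qseries c e) n = fps_nth (qseries (c \<circ> h) (e \<circ> h)) n"
    by (simp add: qseries_nth)
qed

lemma qseries_split:
  assumes "\<And>n. finite {k. e k = n}" "inj g" "inj h" "range g \<inter> range h = {}" "range g \<union> range h = UNIV"
  shows "qseries c e = qseries (c \<circ> g) (e \<circ> g) + qseries (c \<circ> h) (e \<circ> h)"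
proof (rule fps_ext)
  fix n
  have "{k. e k = n} = g ` {k. e (g k) = n} \<union> h ` {k. e (h k) = n}"
    using assms(5) by (auto simp: image_iff)
  moreover have "finite {k. e (g k) = n}" "finite {k. e (h k) = n}"
    using finite_vimageI[OF assms(1)[of n] assms(2)] finite_vimageI[OF assms(1)[of n] assms(3)]
    by (simp_all add: vimage_def)
  ultimately have "(\<Sum>k | e k = n. c k) = (\<Sum>k\<in>g ` {k. e (g k) = n}. c k) + (\<Sum>k\<in>h ` {k. e (h k) = n}. c k)"
    using assms(4) by (auto intro!: sum.union_disjoint)
  also have "\<dots> = (\<Sum>k | e (g k) = n. c (g k)) + (\<Sum>k | e (h k) = n. c (h k))"
    using assms(2,3) by (simp add: sum.reindex inj_on_def)
  finally show "fps_nth (qseries c e) n = fps_nth (qseries (c \<circ> g) (e \<circ> g) + qseries (c \<circ> h) (e \<circ> h)) n"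
    by (simp add: qseries_nth)
qed

lemma qseries_shift: "qseries c (\<lambda>k. e k + m) = fps_X ^ m * qseries c e"
proof (rule fps_ext)
  fix n
  show "fps_nth (qseries c (\<lambda>k. e k + m)) n = fps_nth (fps_X ^ m * qseries c e) n"
  proof (cases "n < m")
    case True
    then have "{k. e k + m = n} = {}" by auto
    then show ?thesis using True by (simp add: qseries_nth fps_X_power_mult_nth)
  next
    case False
    then have "{k. e k + m = n} = {k. e k = n - m}" by auto
    then show ?thesis using False by (simp add: qseries_nth fps_X_power_mult_nth)
  qed
qed

lemma qseries_dilate:
  assumes "m > 0"
  shows "qseries c (\<lambda>k. m * e k) = fps_dilate m (qseries c e)"
proof (rule fps_ext)
  fix n
  show "fps_nth (qseries c (\<lambda>k. m * e k)) n = fps_nth (fps_dilate m (qseries c e)) n"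
  proof (cases "m dvd n")
    case True
    then have "{k. m * e k = n} = {k. e k = n div m}" using assms by auto
    then show ?thesis using True assms by (simp add: qseries_nth fps_dilate_nth)
  next
    case False
    then have "{k. m * e k = n} = {}" by auto
    then show ?thesis using False assms by (simp add: qseries_nth fps_dilate_nth)
  qed
qed

lemma qseries_add: "qseries (\<lambda>k. c k + d k) e = qseries c e + qseries d e"
  by (simp add: fps_eq_iff qseries_nth sum.distrib)

lemma qseries_cmult: "qseries (\<lambda>k. a * c k) e = fps_const a * qseries c e"
  by (simp add: fps_eq_iff qseries_nth sum_distrib_left)

lemma qseries_uminus: "qseries (\<lambda>k. - c k) e = - qseries c e"
  by (simp add: fps_eq_iff qseries_nth sum_negf)

lemma qseries_cong_dvd:
  assumes "\<And>k. numeral m dvd c k - d k"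
  shows "(numeral m :: int fps) dvd qseries c e - qseries d e"
  using assms by (simp add: numeral_dvd_fps_iff qseries_nth dvd_sum flip: sum_subtractf)

text \<open>The growth condition confines the indices of exponent m to the interval from -m-1 to
  m+1. The summand 1 is there for triangular exponents, as \<open>tri (- 1)\<close> is 0.\<close>

lemma qseries_tendsto:
  fixes e :: "int \<Rightarrow> nat"
  assumes "\<And>n. \<bar>n\<bar> \<le> int (e n) + 1"
  shows "(\<lambda>N. \<Sum>n = - int N..int N. fps_const (c n) * fps_X ^ e n) \<longlonglongrightarrow> qseries c e"
proof (rule tendsto_fpsI)
  fix m
  show "\<forall>\<^sub>F N in sequentially. fps_nth (\<Sum>n = - int N..int N. fps_const (c n) * fps_X ^ e n) m = fps_nth (qseries c e) m"
    using eventually_gt_at_top[of m]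
  proof eventually_elim
    case (elim N)
    have "n \<in> {- int N..int N}" if "e n = m" for n
      using assms[of n] that elim by auto
    then have "{n. e n = m} \<subseteq> {- int N..int N}" by auto
    then have "(\<Sum>n | e n = m. c n) = (\<Sum>n = - int N..int N. if e n = m then c n else 0)"
      by (subst sum.inter_filter[symmetric]) (auto intro!: sum.cong)
    then show ?case by (simp add: fps_sum_nth qseries_nth if_distrib eq_commute cong: if_cong)
  qed
qed

lemma finite_int_fibre:
  fixes e :: "int \<Rightarrow> nat"
  assumes "\<And>n. \<bar>n\<bar> \<le> int (e n) + 1"
  shows "finite {n. e n = m}"
proof (rule finite_subset)
  show "{n. e n = m} \<subseteq> {- int m - 1..int m + 1}"
  proof
    fix n assume "n \<in> {n. e n = m}"
    then show "n \<in> {- int m - 1..int m + 1}" using assms[of n] by auto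
  qed
qed simp

subsection \<open>The Jacobi triple product\<close>

text \<open>Gaussian binomial coefficient by its Pascal rule. Without division it makes sense in
  every commutative ring, in particular for series whose coefficients are series.\<close>

fun qbinom :: "'a::comm_ring_1 \<Rightarrow> nat \<Rightarrow> nat \<Rightarrow> 'a" where
  "qbinom q n 0 = 1"
| "qbinom q 0 (Suc k) = 0"
| "qbinom q (Suc n) (Suc k) = qbinom q n k + q ^ Suc k * qbinom q n (Suc k)"

lemma qbinom_eq_0: "n < k \<Longrightarrow> qbinom q n k = 0"
  by (induction q n k rule: qbinom.induct) auto

lemma qbinom_self: "qbinom q n n = 1"
  by (induction n) (simp_all add: qbinom_eq_0)

text \<open>The mirrored Pascal rule. Both are needed: raising \<open>M\<close> in the finite triple
  product calls for this one, raising \<open>N\<close> for the defining one.\<close>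

lemma qbinom_Suc_Suc':
  "k \<le> n \<Longrightarrow> qbinom q (Suc n) (Suc k) = qbinom q n (Suc k) + q ^ (n - k) * qbinom q n k"
proof (induction n arbitrary: k)
  case (Suc n)
  show ?case
  proof (cases k)
    case 0
    have "qbinom q (Suc n) (Suc 0) = qbinom q n (Suc 0) + q ^ n" using Suc.IH[of 0] by simp
    then show ?thesis using 0 by (simp add: algebra_simps)
  next
    case (Suc k')
    show ?thesis
    proof (cases "k = Suc n")
      case True
      then show ?thesis by (simp add: qbinom_self qbinom_eq_0)
    next
      case False
      then have k: "k \<le> n" "k' \<le> n" using Suc Suc.prems by auto
      then obtain d where d: "n = k + d" by (metis le_Suc_ex)
      have "qbinom q (Suc (Suc n)) (Suc k) = qbinom q (Suc n) k + q ^ Suc k * qbinom q (Suc n) (Suc k)"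
        by simp
      also have "qbinom q (Suc n) k = qbinom q n k + q ^ (n - k') * qbinom q n k'"
        using Suc.IH[OF k(2)] Suc by simp
      also have "qbinom q (Suc n) (Suc k) = qbinom q n (Suc k) + q ^ (n - k) * qbinom q n k"
        using Suc.IH[OF k(1)] .
      also have "qbinom q n k + q ^ (n - k') * qbinom q n k' +
          q ^ Suc k * (qbinom q n (Suc k) + q ^ (n - k) * qbinom q n k) =
          (qbinom q n k + q ^ Suc k * qbinom q n (Suc k)) +
          q ^ (n - k') * (qbinom q n k' + q ^ k * qbinom q n k)"
        using d Suc by (simp add: algebra_simps power_add Suc_diff_le)
      also have "\<dots> = qbinom q (Suc n) (Suc k) + q ^ (Suc n - k) * qbinom q (Suc n) k"
        using Suc by simp
      finally show ?thesis .
    qed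
  qed
qed simp

lemma qbinom_prod:
  "qbinom q (k + m) k * (\<Prod>i<k. 1 - q ^ Suc i) * (\<Prod>i<m. 1 - q ^ Suc i) = (\<Prod>i<k + m. 1 - q ^ Suc i)"
proof (induction "k + m" arbitrary: k m)
  case (Suc s)
  show ?case
  proof (cases k; cases m)
    fix k' m' assume km: "k = Suc k'" "m = Suc m'"
    have s: "k' + m = s" "k + m' = s" using km Suc.hyps(2) by auto
    have "qbinom q (k + m) k * (\<Prod>i<k. 1 - q ^ Suc i) * (\<Prod>i<m. 1 - q ^ Suc i) =
        (1 - q ^ k) * (qbinom q s k' * (\<Prod>i<k'. 1 - q ^ Suc i) * (\<Prod>i<m. 1 - q ^ Suc i)) +
        q ^ k * (1 - q ^ m) * (qbinom q s k * (\<Prod>i<k. 1 - q ^ Suc i) * (\<Prod>i<m'. 1 - q ^ Suc i))"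
    proof -
      have "(\<Prod>i<k. 1 - q ^ Suc i) = (\<Prod>i<k'. 1 - q ^ Suc i) * (1 - q ^ k)"
        "(\<Prod>i<m. 1 - q ^ Suc i) = (\<Prod>i<m'. 1 - q ^ Suc i) * (1 - q ^ m)"
        using km by simp_all
      moreover have "qbinom q (k + m) k = qbinom q s k' + q ^ k * qbinom q s k"
        using km s by (metis add_Suc qbinom.simps(3))
      ultimately show ?thesis by (simp only:) (simp only: algebra_simps)
    qed
    also have "\<dots> = (1 - q ^ (k + m)) * (\<Prod>i<s. 1 - q ^ Suc i)"
      using Suc.hyps(1)[of k' m] Suc.hyps(1)[of k m'] s by (simp add: algebra_simps power_add)
    finally show ?thesis using Suc.hyps(2)[symmetric] by (simp add: algebra_simps)
  qed (use Suc.hyps in \<open>auto simp: qbinom_self\<close>)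
qed simp

section \<open>Triangular exponents and the summands of theta series\<close>

definition tri :: "int \<Rightarrow> nat"
  where "tri n = nat (n * (n + 1) div 2)"

lemma tri_double: "2 * int (tri n) = n * (n + 1)"
proof -
  have "n * (n + 1) \<ge> 0" by (cases "n \<ge> 0") (auto simp: mult_nonpos_nonpos)
  then show ?thesis by (simp add: tri_def)
qed

lemma tri_0 [simp]: "tri 0 = 0"
  by (simp add: tri_def)

lemma tri_Suc: "tri (int n + 1) = tri (int n) + Suc n"
  using tri_double[of "int n"] tri_double[of "int n + 1"] by (simp add: algebra_simps)

lemma tri_neg_Suc: "tri (- int n - 1) = tri (- int n) + n"
  using tri_double[of "- int n"] tri_double[of "- int n - 1"] by (simp add: algebra_simps)

lemma tri_diff_tri_uminus: "int (tri n) - int (tri (- n)) = n"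
  using tri_double[of n] tri_double[of "- n"] by (simp add: algebra_simps)

text \<open>Summand a^(n(n+1)/2) b^(n(n-1)/2) of Ramanujan's general theta function. With two bases
  both exponents are natural numbers, so negative n requires no inverse, unlike in z^n
  q^(n^2).\<close>

definition theta_term :: "'a::comm_ring_1 \<Rightarrow> 'a \<Rightarrow> int \<Rightarrow> 'a"
  where "theta_term a b n = a ^ tri n * b ^ tri (- n)"

lemma theta_term_swap: "theta_term b a n = theta_term a b (- n)"
  by (simp add: theta_term_def mult.commute)

lemma theta_term_Suc: "a * (a * b) ^ n * theta_term a b (int n) = theta_term a b (int n + 1)"
  using tri_Suc[of n] tri_neg_Suc[of n]
  by (simp add: theta_term_def power_add power_mult_distrib mult_ac)

lemma theta_term_step:
  assumes "j \<le> M + N"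
  shows "a * (a * b) ^ M * theta_term a b (int j - int N) =
    (a * b) ^ (M + N - j) * theta_term a b (int j - int N + 1)"
proof (cases "j \<ge> N")
  case True
  then obtain p where p: "j = N + p" by (metis le_Suc_ex)
  then have "p \<le> M" using assms by simp
  then have "(a * b) ^ M = (a * b) ^ (M - p) * (a * b) ^ p" by (simp flip: power_add)
  then have "a * (a * b) ^ M * theta_term a b (int p) = (a * b) ^ (M - p) * theta_term a b (int p + 1)"
    unfolding theta_term_Suc[of a b p, symmetric] by (simp add: mult_ac)
  then show ?thesis using p by simp
next
  case False
  then obtain p where p: "N = j + Suc p" using less_imp_Suc_add by (metis add_Suc_right not_le)
  have "theta_term a b (int j - int N) = b * (b * a) ^ p * theta_term b a (int p)"
    using theta_term_Suc[of b a p] theta_term_swap[of b a "int p + 1"] p by (simp add: algebra_simps)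
  moreover have "theta_term b a (int p) = theta_term a b (int j - int N + 1)"
    using theta_term_swap[of b a "int p"] p by (simp add: algebra_simps)
  ultimately show ?thesis using p by (simp add: power_add power_mult_distrib mult_ac)
qed

lemma theta_term_step':
  assumes "j \<le> M + N"
  shows "b * (a * b) ^ N * theta_term a b (int j - int N) = (a * b) ^ j * theta_term a b (int j - int N - 1)"
proof -
  have "b * (b * a) ^ N * theta_term b a (int (M + N - j) - int M) =
      (b * a) ^ (N + M - (M + N - j)) * theta_term b a (int (M + N - j) - int M + 1)"
    by (rule theta_term_step) simp
  then show ?thesis using assms by (simp add: theta_term_swap[of b a] of_nat_diff mult.commute algebra_simps)
qed

text \<open>A form of the q-binomial theorem with the product cut into two pieces. The two lengths
  are independent because Jacobi's cube will need one more factor on the side of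
  \<open>b\<close>.\<close>

theorem finite_triple_product:
  fixes a b :: "'a::comm_ring_1"
  shows "(\<Prod>i<M. 1 + a * (a * b) ^ i) * (\<Prod>i<N. 1 + b * (a * b) ^ i) =
    (\<Sum>j\<le>M + N. qbinom (a * b) (M + N) j * theta_term a b (int j - int N))"
proof (induction N)
  case 0
  show ?case
  proof (induction M)
    case 0
    then show ?case by (simp add: theta_term_def)
  next
    case (Suc M)
    have "(\<Prod>i<Suc M. 1 + a * (a * b) ^ i) =
        (\<Sum>j\<le>M. qbinom (a * b) M j * theta_term a b (int j)) +
        (\<Sum>j\<le>M. qbinom (a * b) M j * (a * (a * b) ^ M * theta_term a b (int j)))"
      using Suc by (simp add: algebra_simps sum_distrib_left sum.distrib)
    also have "(\<Sum>j\<le>M. qbinom (a * b) M j * (a * (a * b) ^ M * theta_term a b (int j))) =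
        (\<Sum>j\<le>M. (a * b) ^ (M - j) * qbinom (a * b) M j * theta_term a b (int (Suc j)))"
    proof (rule sum.cong)
      fix j assume "j \<in> {..M}"
      then show "qbinom (a * b) M j * (a * (a * b) ^ M * theta_term a b (int j)) =
          (a * b) ^ (M - j) * qbinom (a * b) M j * theta_term a b (int (Suc j))"
        using theta_term_step[of j M 0 a b] by (simp add: algebra_simps)
    qed simp
    also have "(\<Sum>j\<le>M. qbinom (a * b) M j * theta_term a b (int j)) =
        1 + (\<Sum>j\<le>M. qbinom (a * b) M (Suc j) * theta_term a b (int (Suc j)))"
    proof -
      have "(\<Sum>j\<le>Suc M. qbinom (a * b) M j * theta_term a b (int j)) =
          1 + (\<Sum>j\<le>M. qbinom (a * b) M (Suc j) * theta_term a b (int (Suc j)))"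
        by (subst sum.atMost_Suc_shift) (simp add: theta_term_def)
      then show ?thesis by (simp add: qbinom_eq_0)
    qed
    also have "1 + (\<Sum>j\<le>M. qbinom (a * b) M (Suc j) * theta_term a b (int (Suc j))) +
        (\<Sum>j\<le>M. (a * b) ^ (M - j) * qbinom (a * b) M j * theta_term a b (int (Suc j))) =
        1 + (\<Sum>j\<le>M. qbinom (a * b) (Suc M) (Suc j) * theta_term a b (int (Suc j)))"
      by (simp add: qbinom_Suc_Suc' algebra_simps sum.distrib del: qbinom.simps(3) of_nat_Suc)
    also have "\<dots> = (\<Sum>j\<le>Suc M. qbinom (a * b) (Suc M) j * theta_term a b (int j))"
      by (subst sum.atMost_Suc_shift) (simp add: theta_term_def)
    finally show ?case by simp
  qed
next
  case (Suc N)
  define S where "S = M + N"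
  have "(\<Prod>i<M. 1 + a * (a * b) ^ i) * (\<Prod>i<Suc N. 1 + b * (a * b) ^ i) =
      (\<Sum>j\<le>S. qbinom (a * b) S j * theta_term a b (int j - int N)) +
      (\<Sum>j\<le>S. qbinom (a * b) S j * (b * (a * b) ^ N * theta_term a b (int j - int N)))"
    using Suc by (simp add: algebra_simps sum_distrib_left sum.distrib S_def)
  also have "(\<Sum>j\<le>S. qbinom (a * b) S j * (b * (a * b) ^ N * theta_term a b (int j - int N))) =
      (\<Sum>j\<le>S. (a * b) ^ j * qbinom (a * b) S j * theta_term a b (int j - int (Suc N)))"
  proof (rule sum.cong)
    fix j assume "j \<in> {..S}"
    then show "qbinom (a * b) S j * (b * (a * b) ^ N * theta_term a b (int j - int N)) =
        (a * b) ^ j * qbinom (a * b) S j * theta_term a b (int j - int (Suc N))"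
      using theta_term_step'[of j M N b a] by (simp add: S_def algebra_simps)
  qed simp
  also have "\<dots> = (\<Sum>j\<le>Suc S. (a * b) ^ j * qbinom (a * b) S j * theta_term a b (int j - int (Suc N)))"
    by (simp add: qbinom_eq_0)
  also have "\<dots> = theta_term a b (- int (Suc N)) +
      (\<Sum>j\<le>S. (a * b) ^ Suc j * qbinom (a * b) S (Suc j) * theta_term a b (int j - int N))"
    by (subst sum.atMost_Suc_shift) simp
  also have "(\<Sum>j\<le>S. qbinom (a * b) S j * theta_term a b (int j - int N)) + \<dots> =
      theta_term a b (- int (Suc N)) + (\<Sum>j\<le>S. qbinom (a * b) (Suc S) (Suc j) * theta_term a b (int j - int N))"
    by (simp add: algebra_simps sum.distrib)
  also have "\<dots> = (\<Sum>j\<le>Suc S. qbinom (a * b) (Suc S) j * theta_term a b (int j - int (Suc N)))"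
    by (subst sum.atMost_Suc_shift) simp
  finally show ?case by (simp add: S_def)
qed

subsection \<open>Congruences\<close>

definition dcong :: "'a::comm_ring_1 \<Rightarrow> 'a \<Rightarrow> 'a \<Rightarrow> bool"
  where "dcong d x y \<longleftrightarrow> d dvd x - y"

lemma dcong_refl [simp]: "dcong d x x"
  by (simp add: dcong_def)

lemma dcong_sym: "dcong d x y \<Longrightarrow> dcong d y x"
  unfolding dcong_def by (metis dvd_minus_iff minus_diff_eq)

lemma dcong_trans [trans]: "dcong d x y \<Longrightarrow> dcong d y z \<Longrightarrow> dcong d x z"
  unfolding dcong_def by (metis diff_add_cancel add_diff_eq dvd_add)

lemma dcong_mult: "dcong d x y \<Longrightarrow> dcong d x' y' \<Longrightarrow> dcong d (x * x') (y * y')"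
proof -
  assume "dcong d x y" "dcong d x' y'"
  moreover have "x * x' - y * y' = (x - y) * x' + y * (x' - y')" by (simp add: algebra_simps)
  ultimately show ?thesis unfolding dcong_def by (metis dvd_add dvd_mult dvd_mult2)
qed

lemma dcong_add: "dcong d x y \<Longrightarrow> dcong d x' y' \<Longrightarrow> dcong d (x + x') (y + y')"
  unfolding dcong_def by (metis add_diff_add dvd_add)

lemma dcong_weaken: "dcong d x y \<Longrightarrow> e dvd d \<Longrightarrow> dcong e x y"
  unfolding dcong_def by (rule dvd_trans)

lemma dcong_cancel:
  fixes f :: "int fps"
  assumes "fps_nth f 0 = 1" "dcong c (f * g) (f * h)"
  shows "dcong c g h"
  using assms dvd_mult_cancel_const_term_1[of f c "g - h"] by (simp add: dcong_def algebra_simps)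

subsection \<open>The infinite triple product\<close>

abbreviation qpoch :: "'a::comm_ring_1 \<Rightarrow> nat \<Rightarrow> 'a"
  where "qpoch q n \<equiv> \<Prod>i<n. 1 - q ^ Suc i"

lemma qpoch_dcong: "m \<le> n \<Longrightarrow> dcong (q ^ Suc m) (qpoch q n) (qpoch q m)"
proof (induction n rule: dec_induct)
  case (step n)
  have "dcong (q ^ Suc m) (1 - q ^ Suc n) 1"
    using step.hyps(1) by (simp add: dcong_def le_imp_power_dvd del: power_Suc)
  from dcong_mult[OF step.IH this] show ?case by simp
qed simp

lemma qpoch_nth_0:
  fixes q :: "int fps"
  shows "fps_nth q 0 = 0 \<Longrightarrow> fps_nth (qpoch q n) 0 = 1"
  by (induction n) (simp_all add: fps_mult_nth_0)

text \<open>By \<open>qbinom_prod\<close> the q-binomial is a quotient of products, and modulo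
  q^(m+1) each of these products equals \<open>qpoch q m\<close> as soon as its length is at least
  m. The common unit then cancels.\<close>

lemma qbinom_qpoch_dcong:
  fixes q :: "int fps"
  assumes "fps_nth q 0 = 0" "m \<le> k" "m \<le> l" "m \<le> n"
  shows "dcong (q ^ Suc m) (qbinom q (k + l) k * qpoch q n) 1"
proof -
  let ?c = "qpoch q m"
  have "dcong (q ^ Suc m) (?c * (qbinom q (k + l) k * qpoch q n)) (?c * (qbinom q (k + l) k * ?c))"
    using assms by (intro dcong_mult dcong_refl qpoch_dcong)
  also have "?c * (qbinom q (k + l) k * ?c) = qbinom q (k + l) k * ?c * ?c" by (simp add: mult_ac)
  also have "dcong (q ^ Suc m) \<dots> (qbinom q (k + l) k * qpoch q k * qpoch q l)"
    using assms by (intro dcong_mult dcong_refl qpoch_dcong[THEN dcong_sym])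
  also have "qbinom q (k + l) k * qpoch q k * qpoch q l = qpoch q (k + l)" by (rule qbinom_prod)
  also have "dcong (q ^ Suc m) \<dots> (?c * 1)"
    using assms qpoch_dcong[of m "k + l" q] by simp
  finally show ?thesis by (rule dcong_cancel[OF qpoch_nth_0[OF assms(1)]])
qed

lemma theta_term_dvd: "(a * b) ^ (nat \<bar>n\<bar> - 1) dvd theta_term a b n"
proof -
  have *: "(a * b) ^ p dvd theta_term a b (int p + 1)" for p and a b :: "'a"
    unfolding theta_term_Suc[symmetric] by (metis dvd_triv_right dvd_mult2)
  define p where "p = nat \<bar>n\<bar> - 1"
  consider "n = 0" | "n = int p + 1" | "n = - (int p + 1)" unfolding p_def by linarith
  then show ?thesis
  proof cases
    case 2
    then show ?thesis using *[where a = a and b = b and p = p] by (simp add: p_def)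
  next
    case 3
    then show ?thesis using *[where a = b and b = a and p = p] theta_term_swap[of b a "int p + 1"]
      by (simp add: mult.commute p_def)
  qed (simp add: p_def)
qed

lemma tri_ge: "\<bar>n\<bar> \<le> int (tri n) + 1"
proof -
  have "(\<bar>n\<bar> - 1) * (\<bar>n\<bar> - 2) \<ge> 0"
  proof (cases "\<bar>n\<bar> \<ge> 2")
    case False
    then have "\<bar>n\<bar> = 0 \<or> \<bar>n\<bar> = 1" by linarith
    then show ?thesis by auto
  qed simp
  moreover have "\<bar>n\<bar> * \<bar>n\<bar> = n * n" by simp
  ultimately have "2 * \<bar>n\<bar> \<le> n * n - \<bar>n\<bar> + 2" by (simp add: algebra_simps)
  moreover have "2 * int (tri n) = n * n + n" using tri_double[of n] by (simp add: algebra_simps)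
  ultimately show ?thesis by linarith
qed

lemma sum_atMost_int_shift: "(\<Sum>j\<le>2 * N. f (int j - int N)) = (\<Sum>n = - int N..int N. f n)"
  by (rule sum.reindex_bij_witness[where i = "\<lambda>n. nat (n + int N)" and j = "\<lambda>j. int j - int N"]) auto

text \<open>The bases are \<sigma> X^r and \<sigma> X^s with a sign \<sigma>. One statement thus
  covers \<phi>(q) and \<phi>(-q) with (r, s) = (1, 1), \<psi> with (3, 1), and the pentagonal
  series with (2, 1).\<close>

theorem triple_product_tendsto:
  fixes r s :: nat and \<sigma> :: int
  assumes "r + s > 0" and \<sigma>: "\<sigma> * \<sigma> = 1"
  shows "(\<lambda>N. (\<Prod>i<N. 1 + fps_const \<sigma> * fps_X ^ (r + (r + s) * i)) *
      (\<Prod>i<N. 1 + fps_const \<sigma> * fps_X ^ (s + (r + s) * i)) * qpoch (fps_X ^ (r + s)) N) \<longlonglongrightarrow>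
    qseries (\<lambda>n. \<sigma> ^ (tri n + tri (- n))) (\<lambda>n. r * tri n + s * tri (- n))"
proof (rule fps_tendsto_cong_dvd[OF qseries_tendsto])
  fix n
  have "tri n \<le> r * tri n \<or> tri (- n) \<le> s * tri (- n)"
    using assms(1) by (cases r; cases s) auto
  then have "tri n \<le> r * tri n + s * tri (- n) \<or> tri (- n) \<le> r * tri n + s * tri (- n)"
    by linarith
  then show "\<bar>n\<bar> \<le> int (r * tri n + s * tri (- n)) + 1"
    using tri_ge[of n] tri_ge[of "- n"] by linarith
next
  fix N
  define a b q where "a = fps_const \<sigma> * fps_X ^ r" and "b = fps_const \<sigma> * fps_X ^ s"
    and "q = (fps_X ^ (r + s) :: int fps)"
  have ab: "a * b = q"
    using \<sigma> by (simp add: a_def b_def q_def power_add mult_ac)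
  have q0: "fps_nth q 0 = 0" using assms(1) by (simp add: q_def)
  have "(\<Prod>i<N. 1 + a * q ^ i) * (\<Prod>i<N. 1 + b * q ^ i) * qpoch q N =
      (\<Sum>j\<le>2 * N. theta_term a b (int j - int N) * (qbinom q (2 * N) j * qpoch q N))"
    unfolding finite_triple_product[of a b N N, unfolded ab] sum_distrib_right mult_2 by (simp only: mult_ac)
  moreover have "fps_X ^ N dvd (\<Sum>j\<le>2 * N. theta_term a b (int j - int N) * (qbinom q (2 * N) j * qpoch q N)) -
      (\<Sum>j\<le>2 * N. theta_term a b (int j - int N))"
    unfolding sum_subtractf[symmetric]
  proof (rule dvd_sum)
    fix j assume "j \<in> {..2 * N}"
    \<comment> \<open>\<open>m\<close> is the distance from j to the nearer end of the range 0..2N.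
      Two sources of smallness add up: with n = j - N the theta term contributes q^(|n|-1) and the
      q-binomial error q^(m+1), together at least q^N.\<close>
    define m where "m = N - nat \<bar>int j - int N\<bar>"
    have m: "m \<le> j" "m \<le> 2 * N - j" "m \<le> N" "N \<le> nat \<bar>int j - int N\<bar> - 1 + Suc m"
      using \<open>j \<in> {..2 * N}\<close> unfolding m_def by auto
    have "q ^ Suc m dvd qbinom q (2 * N) j * qpoch q N - 1"
      using qbinom_qpoch_dcong[OF q0 m(1-3)] \<open>j \<in> {..2 * N}\<close> by (simp add: dcong_def)
    then have "q ^ (nat \<bar>int j - int N\<bar> - 1) * q ^ Suc m dvd
        theta_term a b (int j - int N) * (qbinom q (2 * N) j * qpoch q N - 1)"
      using theta_term_dvd[of a b "int j - int N"] by (intro mult_dvd_mono) (simp_all add: ab)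
    moreover have "q ^ N dvd q ^ (nat \<bar>int j - int N\<bar> - 1) * q ^ Suc m"
      unfolding power_add[symmetric] by (rule le_imp_power_dvd[OF m(4)])
    moreover have "fps_X ^ N dvd q ^ N"
      using assms(1) by (intro dvd_power_same) (simp add: q_def dvd_power)
    ultimately have "fps_X ^ N dvd theta_term a b (int j - int N) * (qbinom q (2 * N) j * qpoch q N - 1)"
      by (meson dvd_trans)
    then show "fps_X ^ N dvd theta_term a b (int j - int N) * (qbinom q (2 * N) j * qpoch q N) -
        theta_term a b (int j - int N)"
      by (simp add: algebra_simps)
  qed
  moreover have "(\<Sum>j\<le>2 * N. theta_term a b (int j - int N)) = (\<Sum>n = - int N..int N. theta_term a b n)"
    by (rule sum_atMost_int_shift)
  moreover have "theta_term a b n = fps_const (\<sigma> ^ (tri n + tri (- n))) * fps_X ^ (r * tri n + s * tri (- n))" for n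
    by (simp add: theta_term_def a_def b_def power_mult_distrib power_add fps_const_power mult_ac
        flip: power_mult fps_const_mult)
  moreover have "a * q ^ i = fps_const \<sigma> * fps_X ^ (r + (r + s) * i)"
    "b * q ^ i = fps_const \<sigma> * fps_X ^ (s + (r + s) * i)" for i
    by (simp_all add: a_def b_def q_def power_add power_mult mult.assoc)
  ultimately show "fps_X ^ N dvd (\<Prod>i<N. 1 + fps_const \<sigma> * fps_X ^ (r + (r + s) * i)) *
      (\<Prod>i<N. 1 + fps_const \<sigma> * fps_X ^ (s + (r + s) * i)) * qpoch (fps_X ^ (r + s)) N -
      (\<Sum>n = - int N..int N. fps_const (\<sigma> ^ (tri n + tri (- n))) * fps_X ^ (r * tri n + s * tri (- n)))"
    by (simp only: flip: q_def)
qed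

subsection \<open>Jacobi's identity for the cube of Euler's product\<close>

definition euler :: "int fps"
  where "euler = fps_infprod (\<lambda>i. 1 - fps_X ^ Suc i)"

lemma euler_tendsto: "qpoch fps_X \<longlonglongrightarrow> euler"
  unfolding euler_def by (rule fps_infprod_tendsto) simp

lemma euler_nth_0 [simp]: "fps_nth euler 0 = 1"
  unfolding euler_def by (rule fps_infprod_nth_0) simp

lemma qpoch_dilate: "k > 0 \<Longrightarrow> fps_dilate k (qpoch fps_X N) = qpoch (fps_X ^ k) N"
  by (simp add: fps_dilate_prod fps_dilate_simps fps_dilate_power del: power_Suc)

lemma euler_dilate_tendsto: "k > 0 \<Longrightarrow> qpoch (fps_X ^ k) \<longlonglongrightarrow> fps_dilate k euler"
  using fps_dilate_tendsto[OF euler_tendsto] by (simp only: qpoch_dilate)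

text \<open>Jacobi's sum of (-1)^n (2n+1) q^(n(n+1)/2) over n \<ge> 0, unfolded to all integers: n
  and -1-n share their exponent, and their coefficients add up to (-1)^n (2n+1). The sign is written
  with exponent n^2, which has the parity of n.\<close>

definition jacobi_cube :: "int fps"
  where "jacobi_cube = qseries (\<lambda>n. (-1) ^ (tri n + tri (- n)) * n) tri"

lemma qbinom_fps_const: "qbinom (fps_const q) n k = fps_const (qbinom q n k)"
  by (induction q n k rule: qbinom.induct) (simp_all add: fps_const_power flip: fps_const_add fps_const_mult)

lemma fps_nth_1_mult: "fps_nth (f * g) 1 = fps_nth f 0 * fps_nth g 1 + fps_nth f 1 * fps_nth g 0"
  by (simp add: fps_mult_nth)

lemma fps_power_nth_1:
  fixes f :: "'a::comm_ring_1 fps"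
  assumes "fps_nth f 0 = 1"
  shows "fps_nth (f ^ n) 1 = of_nat n * fps_nth f 1"
  using assms by (induction n) (simp_all add: fps_nth_1_mult fps_nth_power_0 algebra_simps del: One_nat_def)

lemma fps_prod_nth_0: "fps_nth (\<Prod>i\<in>A. f i) 0 = (\<Prod>i\<in>A. fps_nth (f i) 0 :: 'a::comm_ring_1)"
  by (induction A rule: infinite_finite_induct) (simp_all add: fps_mult_nth_0)

text \<open>
  The identity is the derivative of the triple product at its zero: perturb both bases to first
  order in a second variable \<open>Y\<close> and compare the coefficients of \<open>Y\<close>.
\<close>

lemma finite_jacobi_cube:
  fixes q :: "int fps"
  shows "qpoch q N ^ 2 = (\<Sum>j\<le>2 * N + 1. qbinom q (2 * N + 1) j *
    (fps_const ((-1) ^ (tri (int j - int (Suc N)) + tri (- (int j - int (Suc N)))) * (int j - int (Suc N))) *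
      q ^ tri (int j - int (Suc N))))"
proof -
  define y where "y = (1 + fps_X :: int fps fps)"
  define g where "g = fps_right_inverse y 1"
  define a b where "a = - (fps_const q * g)" and "b = - y"
  have yg: "y * g = 1" unfolding g_def by (rule fps_right_inverse) (simp add: y_def)
  have y: "fps_nth y 0 = 1" "fps_nth y 1 = 1" by (simp_all add: y_def)
  have g0: "fps_nth g 0 = 1" using arg_cong[OF yg, of "\<lambda>f. fps_nth f 0"] y by (simp add: fps_mult_nth_0)
  have g1: "fps_nth g 1 = - 1"
    using arg_cong[OF yg, of "\<lambda>f. fps_nth f 1"] y g0 by (simp add: fps_nth_1_mult eq_neg_iff_add_eq_0 del: One_nat_def)
  have ab: "a * b = fps_const q" using yg by (simp add: a_def b_def mult_ac)
  \<comment> \<open>The exponents \<open>tri n\<close> of 1/(1+Y) and \<open>tri (- n)\<close> of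
    1+Y differentiate to \<open>tri (- n)\<close> minus \<open>tri n\<close>, which is -n. This is
    the origin of the factor n in Jacobi's series.\<close>
  have nth_1: "fps_nth (theta_term a b n) 1 =
      - (fps_const ((-1) ^ (tri n + tri (- n)) * n) * q ^ tri n)" for n
  proof -
    have "theta_term a b n = fps_const ((-1) ^ (tri n + tri (- n)) * q ^ tri n) * (g ^ tri n * y ^ tri (- n))"
    proof -
      have "a = fps_const (- q) * g" by (simp add: a_def flip: fps_const_neg)
      moreover have "b = fps_const (- 1) * y" by (simp add: b_def flip: fps_const_neg)
      ultimately show ?thesis
        by (simp add: theta_term_def power_mult_distrib fps_const_power power_minus[of q] power_add mult_ac
            flip: fps_const_mult)
    qed
    moreover have "fps_nth (g ^ tri n * y ^ tri (- n)) 1 = of_nat (tri (- n)) - of_nat (tri n)"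
      using g0 g1 y by (simp only: fps_nth_1_mult fps_nth_power_0 fps_power_nth_1) simp
    moreover have "of_nat (tri (- n)) - of_nat (tri n) = (of_int (- n) :: int fps)"
    proof -
      have "int (tri (- n)) - int (tri n) = - n" using tri_diff_tri_uminus[of n] by linarith
      then show ?thesis by (metis of_int_diff of_int_of_nat_eq)
    qed
    ultimately have "fps_nth (theta_term a b n) 1 = (-1) ^ (tri n + tri (- n)) * q ^ tri n * of_int (- n)"
      by (simp only: fps_mult_left_const_nth)
    also have "of_int (- n) = - fps_const n"
      by (metis fps_of_int of_int_eq_id id_apply of_int_minus)
    also have "(-1) ^ (tri n + tri (- n)) = fps_const ((-1) ^ (tri n + tri (- n)) :: int)"
      by (metis fps_const_power fps_const_neg fps_const_1_eq_1)
    finally show ?thesis unfolding fps_const_mult[symmetric] by (simp only: mult_ac mult_minus_left mult_minus_right)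
  qed
  \<comment> \<open>The factor i = 0 of the longer product is 1 + b = -Y. The coefficient of Y is
    therefore minus the remaining product at Y = 0, where a = -q and b = -1 make both pieces equal
    to \<open>qpoch q N\<close>.\<close>
  have "(\<Prod>i<N. 1 + a * fps_const q ^ i) * (\<Prod>i<Suc N. 1 + b * fps_const q ^ i) =
      - (fps_X * ((\<Prod>i<N. 1 + a * fps_const q ^ i) * (\<Prod>i<N. 1 + b * fps_const q ^ Suc i)))"
    by (subst prod.lessThan_Suc_shift) (simp add: b_def y_def)
  moreover have "fps_nth (- (fps_X * ((\<Prod>i<N. 1 + a * fps_const q ^ i) * (\<Prod>i<N. 1 + b * fps_const q ^ Suc i)))) 1 =
      - (qpoch q N ^ 2)"
    using g0 y by (simp add: fps_nth_1_mult fps_mult_nth_0 fps_prod_nth_0 fps_nth_power_0 a_def b_def power2_eq_square del: One_nat_def)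
  ultimately have "- (qpoch q N ^ 2) =
      fps_nth (\<Sum>j\<le>N + Suc N. qbinom (fps_const q) (N + Suc N) j * theta_term a b (int j - int (Suc N))) 1"
    using finite_triple_product[of a b N "Suc N"] by (simp only: ab)
  also have "\<dots> = (\<Sum>j\<le>N + Suc N. qbinom q (N + Suc N) j * fps_nth (theta_term a b (int j - int (Suc N))) 1)"
    by (simp only: fps_sum_nth qbinom_fps_const fps_mult_left_const_nth)
  also have "N + Suc N = 2 * N + 1" by simp
  finally show ?thesis by (simp only: nth_1 mult_minus_right sum_negf neg_equal_iff_equal)
qed


lemma dvd_diff_add_left:
  fixes d :: "'a::comm_ring_1"
  assumes "d dvd x - (u + z)" "d dvd u"
  shows "d dvd x - z"
proof -
  have "x - z = (x - (u + z)) + u" by simp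
  then show ?thesis using assms by (metis dvd_add)
qed

theorem euler_cube: "euler ^ 3 = jacobi_cube"
proof -
  define t :: "int \<Rightarrow> int fps"
    where "t n = fps_const ((-1) ^ (tri n + tri (- n)) * n) * fps_X ^ tri n" for n
  have "(\<lambda>N. \<Sum>n = - int N..int N. t n) \<longlonglongrightarrow> jacobi_cube"
    unfolding t_def jacobi_cube_def by (rule qseries_tendsto) (rule tri_ge)
  then have "(\<lambda>N. qpoch fps_X N ^ 2 * qpoch fps_X N) \<longlonglongrightarrow> jacobi_cube"
  proof (rule fps_tendsto_cong_dvd)
    fix N
    have X_dvd: "fps_X ^ (nat \<bar>n\<bar> - 1) dvd t n" for n
      unfolding t_def using tri_ge[of n] by (intro dvd_mult le_imp_power_dvd) auto
    have "qpoch fps_X N ^ 2 * qpoch fps_X N =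
        (\<Sum>j\<le>2 * N + 1. t (int j - int (Suc N)) * (qbinom fps_X (2 * N + 1) j * qpoch fps_X N))"
      unfolding finite_jacobi_cube t_def sum_distrib_right by (intro sum.cong refl) (simp only: mult_ac)
    moreover have "fps_X ^ N dvd (\<Sum>j\<le>2 * N + 1. t (int j - int (Suc N)) * (qbinom fps_X (2 * N + 1) j * qpoch fps_X N)) -
        (\<Sum>j\<le>2 * N + 1. t (int j - int (Suc N)))"
      unfolding sum_subtractf[symmetric]
    proof (rule dvd_sum)
      fix j assume j: "j \<in> {..2 * N + 1}"
      define n m where "n = int j - int (Suc N)" and "m = N - nat \<bar>n\<bar>"
      have m: "m \<le> j" "m \<le> 2 * N + 1 - j" "m \<le> N" "N \<le> nat \<bar>n\<bar> - 1 + Suc m"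
        using j unfolding m_def n_def by auto
      have "(fps_X :: int fps) ^ Suc m dvd qbinom fps_X (2 * N + 1) j * qpoch fps_X N - 1"
        using qbinom_qpoch_dcong[OF _ m(1-3), of fps_X] j by (simp add: dcong_def)
      then have "fps_X ^ (nat \<bar>n\<bar> - 1) * fps_X ^ Suc m dvd t n * (qbinom fps_X (2 * N + 1) j * qpoch fps_X N - 1)"
        using X_dvd by (intro mult_dvd_mono)
      moreover have "(fps_X :: int fps) ^ N dvd fps_X ^ (nat \<bar>n\<bar> - 1) * fps_X ^ Suc m"
        unfolding power_add[symmetric] by (rule le_imp_power_dvd[OF m(4)])
      ultimately have "fps_X ^ N dvd t n * (qbinom fps_X (2 * N + 1) j * qpoch fps_X N - 1)"
        by (meson dvd_trans)
      then show "fps_X ^ N dvd t (int j - int (Suc N)) * (qbinom fps_X (2 * N + 1) j * qpoch fps_X N) - t (int j - int (Suc N))"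
        by (simp add: algebra_simps n_def)
    qed
    moreover have "(\<Sum>j\<le>2 * N + 1. t (int j - int (Suc N))) = t (- int (Suc N)) + (\<Sum>n = - int N..int N. t n)"
    proof -
      have "(\<Sum>j\<le>Suc (2 * N). t (int j - int (Suc N))) = t (- int (Suc N)) + (\<Sum>j\<le>2 * N. t (int j - int N))"
        by (subst sum.atMost_Suc_shift) (simp add: algebra_simps)
      then show ?thesis by (simp add: sum_atMost_int_shift)
    qed
    moreover have "fps_X ^ N dvd t (- int (Suc N))" using X_dvd[of "- int (Suc N)"] by (simp only: abs_minus_cancel abs_of_nat nat_int diff_Suc_1)
    ultimately show "fps_X ^ N dvd qpoch fps_X N ^ 2 * qpoch fps_X N - (\<Sum>n = - int N..int N. t n)"
      using dvd_diff_add_left by (simp only:)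
  qed
  moreover have "(\<lambda>N. qpoch fps_X N ^ 2 * qpoch fps_X N) \<longlonglongrightarrow> euler ^ 2 * euler"
    unfolding power2_eq_square by (intro fps_tendsto_mult euler_tendsto)
  ultimately have "euler ^ 2 * euler = jacobi_cube"
    by (rule sym[OF LIMSEQ_unique])
  then show ?thesis by (simp add: power3_eq_cube power2_eq_square)
qed

subsection \<open>Theta functions\<close>

lemma qseries_residues:
  assumes "m > 0" "\<And>n. finite {k. e k = n}"
  shows "qseries c e = (\<Sum>r<m. qseries (\<lambda>k. c (int m * k + int r)) (\<lambda>k. e (int m * k + int r)))"
proof (rule fps_ext)
  fix n
  have fin: "finite {k. e (int m * k + int r) = n}" for r
    using finite_vimageI[OF assms(2)[of n], of "\<lambda>k. int m * k + int r"] assms(1)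
    by (simp add: vimage_def inj_on_def)
  have "(\<Sum>r<m. \<Sum>k | e (int m * k + int r) = n. c (int m * k + int r)) =
      (\<Sum>(r, k)\<in>(SIGMA r:{..<m}. {k. e (int m * k + int r) = n}). c (int m * k + int r))"
    using fin by (subst sum.Sigma) auto
  also have "\<dots> = (\<Sum>k | e k = n. c k)"
    using assms(1)
    by (intro sum.reindex_bij_witness[where i = "\<lambda>k. (nat (k mod int m), k div int m)"
          and j = "\<lambda>(r, k). int m * k + int r"]) (auto simp: nat_less_iff)
  finally show "fps_nth (qseries c e) n =
      fps_nth (\<Sum>r<m. qseries (\<lambda>k. c (int m * k + int r)) (\<lambda>k. e (int m * k + int r))) n"
    by (simp add: qseries_nth fps_sum_nth)
qed

lemma tri_fibre: "finite {k. tri k = n}"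
  by (rule finite_int_fibre) (rule tri_ge)

text \<open>The exponent is \<open>n^2\<close>, so \<open>theta 1\<close> is \<open>\<phi>(q)\<close> and \<open>theta (-1)\<close> is \<open>\<phi>(-q)\<close>.\<close>

definition theta :: "int \<Rightarrow> int fps"
  where "theta \<sigma> = qseries (\<lambda>n. \<sigma> ^ (tri n + tri (- n))) (\<lambda>n. tri n + tri (- n))"

text \<open>The exponent \<open>n (2 n + 1)\<close> takes every triangular value exactly once as \<open>n\<close> runs over the integers.\<close>

definition psi :: "int fps"
  where "psi = qseries (\<lambda>n. 1) (\<lambda>n. 3 * tri n + tri (- n))"

lemma tri_add_tri_uminus: "int (tri n + tri (- n)) = n * n"
  using tri_double[of n] tri_double[of "- n"] by (simp add: algebra_simps)

lemma minus_one_power_tri: "(-1) ^ (tri n + tri (- n)) = (if even n then 1 else -1 :: int)"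
proof -
  have "even (tri n + tri (- n)) \<longleftrightarrow> even n"
    using tri_add_tri_uminus[of n] by (metis even_mult_iff even_of_nat)
  then show ?thesis by (simp add: minus_one_power_iff)
qed

lemma square_ge: "\<bar>n\<bar> \<le> int (tri n + tri (- n)) + 1"
  using tri_ge[of n] by simp

lemma square_fibre: "finite {k. tri k + tri (- k) = n}"
  by (rule finite_int_fibre) (rule square_ge)

lemma prod_double:
  fixes N :: nat
  shows "(\<Prod>i<2 * N. f i) = (\<Prod>i<N. f (2 * i)) * (\<Prod>i<N. f (2 * i + 1) :: 'a::comm_monoid_mult)"
  by (induction N) (simp_all add: mult_ac)

lemma prod_triple:
  fixes N :: nat
  shows "(\<Prod>i<3 * N. f i) = (\<Prod>i<N. f (3 * i)) * (\<Prod>i<N. f (3 * i + 1)) * (\<Prod>i<N. f (3 * i + 2) :: 'a::comm_monoid_mult)"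
proof (induction N)
  case (Suc N)
  have "3 * Suc N = Suc (Suc (Suc (3 * N)))" by simp
  then show ?case by (simp only: prod.lessThan_Suc Suc) (simp add: mult_ac)
qed simp

definition odd_prod :: "int \<Rightarrow> int fps"
  where "odd_prod \<sigma> = fps_infprod (\<lambda>i. 1 + fps_const \<sigma> * fps_X ^ (2 * i + 1))"

lemma odd_prod_tendsto: "(\<lambda>N. \<Prod>i<N. 1 + fps_const \<sigma> * fps_X ^ (2 * i + 1)) \<longlonglongrightarrow> odd_prod \<sigma>"
  unfolding odd_prod_def
  by (rule fps_infprod_tendsto) (simp add: le_imp_power_dvd dvd_mult del: power_Suc)

lemma odd_prod_nth_0 [simp]: "fps_nth (odd_prod \<sigma>) 0 = 1"
  unfolding odd_prod_def by (rule fps_infprod_nth_0) simp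

theorem theta_product:
  assumes "\<sigma> * \<sigma> = 1"
  shows "theta \<sigma> = odd_prod \<sigma> ^ 2 * fps_dilate 2 euler"
proof -
  have "(\<lambda>N. (\<Prod>i<N. 1 + fps_const \<sigma> * fps_X ^ (2 * i + 1)) * (\<Prod>i<N. 1 + fps_const \<sigma> * fps_X ^ (2 * i + 1)) *
      qpoch (fps_X ^ 2) N) \<longlonglongrightarrow> theta \<sigma>"
    using triple_product_tendsto[of 1 1 \<sigma>] assms by (simp add: theta_def numeral_2_eq_2)
  moreover have "(\<lambda>N. (\<Prod>i<N. 1 + fps_const \<sigma> * fps_X ^ (2 * i + 1)) *
      (\<Prod>i<N. 1 + fps_const \<sigma> * fps_X ^ (2 * i + 1)) * qpoch (fps_X ^ 2) N) \<longlonglongrightarrow>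
      odd_prod \<sigma> * odd_prod \<sigma> * fps_dilate 2 euler"
    by (intro fps_tendsto_mult odd_prod_tendsto euler_dilate_tendsto) simp
  ultimately show ?thesis unfolding power2_eq_square by (rule LIMSEQ_unique)
qed

lemma odd_prod_mult: "odd_prod (-1) * odd_prod 1 = fps_dilate 2 (odd_prod (-1))"
proof (rule LIMSEQ_unique)
  show "(\<lambda>N. (\<Prod>i<N. 1 + fps_const (-1) * fps_X ^ (2 * i + 1)) * (\<Prod>i<N. 1 + fps_const 1 * fps_X ^ (2 * i + 1)))
      \<longlonglongrightarrow> odd_prod (-1) * odd_prod 1"
    by (intro fps_tendsto_mult odd_prod_tendsto)
  have "(\<lambda>N. fps_dilate 2 (\<Prod>i<N. 1 + fps_const (-1) * fps_X ^ (2 * i + 1))) \<longlonglongrightarrow> fps_dilate 2 (odd_prod (-1))"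
    by (intro fps_dilate_tendsto odd_prod_tendsto) simp
  moreover have "fps_dilate 2 (\<Prod>i<N. 1 + fps_const (-1) * fps_X ^ (2 * i + 1)) =
      (\<Prod>i<N. 1 + fps_const (-1) * fps_X ^ (2 * i + 1)) * (\<Prod>i<N. 1 + fps_const 1 * fps_X ^ (2 * i + 1))" for N
    unfolding prod.distrib[symmetric] fps_dilate_prod[OF zero_less_numeral]
    by (intro prod.cong refl)
      (simp add: fps_dilate_simps algebra_simps power_add power2_eq_square power_mult_distrib flip: power_mult fps_const_neg del: power_Suc)
  ultimately show "(\<lambda>N. (\<Prod>i<N. 1 + fps_const (-1) * fps_X ^ (2 * i + 1)) *
      (\<Prod>i<N. 1 + fps_const 1 * fps_X ^ (2 * i + 1))) \<longlonglongrightarrow> fps_dilate 2 (odd_prod (-1))"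
    by simp
qed

lemma odd_prod_euler: "odd_prod (-1) * fps_dilate 2 euler = euler"
proof (rule LIMSEQ_unique)
  show "(\<lambda>N. (\<Prod>i<N. 1 + fps_const (-1) * fps_X ^ (2 * i + 1)) * qpoch (fps_X ^ 2) N) \<longlonglongrightarrow>
      odd_prod (-1) * fps_dilate 2 euler"
    by (intro fps_tendsto_mult odd_prod_tendsto euler_dilate_tendsto) simp
  have "(\<lambda>N. qpoch fps_X (2 * N)) \<longlonglongrightarrow> euler"
    by (rule LIMSEQ_subseq_LIMSEQ[OF euler_tendsto, of "\<lambda>N. 2 * N", unfolded comp_def]) (simp add: strict_mono_def)
  then show "(\<lambda>N. (\<Prod>i<N. 1 + fps_const (-1) * fps_X ^ (2 * i + 1)) * qpoch (fps_X ^ 2) N) \<longlonglongrightarrow> euler"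
    unfolding prod_double by (simp add: power_mult[symmetric] mult.assoc flip: fps_const_neg power_Suc)
qed

text \<open>With (r, s) = (3, 1) the factors have exponents 3 and 1 modulo 4, which interleave to
  all odd exponents.\<close>

theorem psi_product: "psi = odd_prod 1 * fps_dilate 4 euler"
proof (rule LIMSEQ_unique)
  show "(\<lambda>N. (\<Prod>i<N. 1 + fps_const 1 * fps_X ^ (3 + 4 * i)) * (\<Prod>i<N. 1 + fps_const 1 * fps_X ^ (1 + 4 * i)) *
      qpoch (fps_X ^ 4) N) \<longlonglongrightarrow> psi"
    using triple_product_tendsto[of 3 1 1] by (simp add: psi_def)
  have "(\<lambda>N. \<Prod>i<2 * N. 1 + fps_const 1 * fps_X ^ (2 * i + 1)) \<longlonglongrightarrow> odd_prod 1"
    by (rule LIMSEQ_subseq_LIMSEQ[OF odd_prod_tendsto, of "\<lambda>N. 2 * N", unfolded comp_def]) (simp add: strict_mono_def)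
  then have "(\<lambda>N. (\<Prod>i<N. 1 + fps_const 1 * fps_X ^ (3 + 4 * i)) * (\<Prod>i<N. 1 + fps_const 1 * fps_X ^ (1 + 4 * i)))
      \<longlonglongrightarrow> odd_prod 1"
    unfolding prod_double by (simp add: mult.commute numeral_3_eq_3)
  then show "(\<lambda>N. (\<Prod>i<N. 1 + fps_const 1 * fps_X ^ (3 + 4 * i)) * (\<Prod>i<N. 1 + fps_const 1 * fps_X ^ (1 + 4 * i)) *
      qpoch (fps_X ^ 4) N) \<longlonglongrightarrow> odd_prod 1 * fps_dilate 4 euler"
    by (intro fps_tendsto_mult euler_dilate_tendsto) auto
qed

theorem pentagonal_number_theorem:
  "euler = qseries (\<lambda>n. (-1) ^ (tri n + tri (- n))) (\<lambda>n. 2 * tri n + tri (- n))"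
proof (rule LIMSEQ_unique)
  show "(\<lambda>N. (\<Prod>i<N. 1 + fps_const (-1) * fps_X ^ (2 + 3 * i)) * (\<Prod>i<N. 1 + fps_const (-1) * fps_X ^ (1 + 3 * i)) *
      qpoch (fps_X ^ 3) N) \<longlonglongrightarrow> qseries (\<lambda>n. (-1) ^ (tri n + tri (- n))) (\<lambda>n. 2 * tri n + tri (- n))"
    using triple_product_tendsto[of 2 1 "-1"] by simp
  have "(\<lambda>N. qpoch fps_X (3 * N)) \<longlonglongrightarrow> euler"
    by (rule LIMSEQ_subseq_LIMSEQ[OF euler_tendsto, of "\<lambda>N. 3 * N", unfolded comp_def]) (simp add: strict_mono_def)
  moreover have "1 + fps_const (-1) * fps_X ^ (2 + 3 * i) = (1 - fps_X ^ Suc (3 * i + 1) :: int fps)"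
      "1 + fps_const (-1) * fps_X ^ (1 + 3 * i) = (1 - fps_X ^ Suc (3 * i) :: int fps)"
      "1 - (fps_X ^ 3) ^ Suc i = (1 - fps_X ^ Suc (3 * i + 2) :: int fps)" for i
    by (simp_all flip: fps_const_neg power_mult del: power_Suc)
  then have "(\<Prod>i<N. 1 + fps_const (-1) * fps_X ^ (2 + 3 * i)) * (\<Prod>i<N. 1 + fps_const (-1) * fps_X ^ (1 + 3 * i)) *
      qpoch (fps_X ^ 3) N = (qpoch fps_X (3 * N) :: int fps)" for N
    by (simp only: prod_triple) (simp only: mult_ac)
  ultimately show "(\<lambda>N. (\<Prod>i<N. 1 + fps_const (-1) * fps_X ^ (2 + 3 * i)) * (\<Prod>i<N. 1 + fps_const (-1) * fps_X ^ (1 + 3 * i)) *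
      qpoch (fps_X ^ 3) N) \<longlonglongrightarrow> euler"
    by (simp only:)
qed

text \<open>Together with \<open>theta_minus_euler\<close> this writes \<psi> as E(q^2)^2 / E(q) and
  \<phi>(-q) as E(q)^2 / E(q^2), the bridge from theta functions to powers of E.\<close>

lemma psi_euler: "psi * euler = fps_dilate 2 euler ^ 2"
proof -
  have "fps_dilate 2 (odd_prod (-1)) * fps_dilate 4 euler = fps_dilate 2 euler"
    using arg_cong[OF odd_prod_euler, of "fps_dilate 2"] by (simp add: fps_dilate_simps)
  moreover have "psi * euler = psi * (odd_prod (-1) * fps_dilate 2 euler)"
    by (simp only: odd_prod_euler)
  moreover have "\<dots> = fps_dilate 2 (odd_prod (-1)) * fps_dilate 4 euler * fps_dilate 2 euler"
    by (simp add: psi_product mult_ac flip: odd_prod_mult)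
  ultimately show ?thesis by (simp add: power2_eq_square)
qed

lemma theta_minus_euler: "theta (-1) * fps_dilate 2 euler = euler ^ 2"
proof -
  have "theta (-1) * fps_dilate 2 euler = (odd_prod (-1) * fps_dilate 2 euler) ^ 2"
    by (simp add: theta_product power2_eq_square mult_ac)
  then show ?thesis by (simp only: odd_prod_euler)
qed

lemma psi_square: "psi ^ 2 = theta 1 * fps_dilate 2 psi"
proof -
  have "fps_dilate 2 psi * fps_dilate 2 euler = fps_dilate 4 euler ^ 2"
    using arg_cong[OF psi_euler, of "fps_dilate 2"] by (simp add: fps_dilate_simps)
  then show ?thesis
    by (subst psi_product, subst theta_product) (simp_all add: power_mult_distrib mult_ac)
qed

lemma theta_mult_theta: "theta 1 * theta (-1) = fps_dilate 2 (theta (-1)) ^ 2"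
proof -
  have *: "fps_dilate 2 (odd_prod (-1)) * fps_dilate 4 euler = fps_dilate 2 euler"
    using arg_cong[OF odd_prod_euler, of "fps_dilate 2"] by (simp add: fps_dilate_simps)
  have "theta 1 * theta (-1) = (odd_prod (-1) * odd_prod 1) ^ 2 * fps_dilate 2 euler ^ 2"
    by (simp add: theta_product power2_eq_square mult_ac)
  also have "\<dots> = fps_dilate 2 (theta (-1)) ^ 2"
    unfolding odd_prod_mult *[symmetric] by (simp add: theta_product fps_dilate_simps power2_eq_square mult_ac)
  finally show ?thesis .
qed

section \<open>Dissections by parity\<close>

lemma qseries_tri: "qseries (\<lambda>_. 1) tri = 2 * psi"
proof -
  \<comment> \<open>Even indices 2k, and odd ones after the reflection k to -1-k, both have exponent
    k(2k+1); hence the factor 2.\<close>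
  have "tri (2 * k) = 3 * tri k + tri (- k)" for k
    using tri_double[of "2 * k"] tri_double[of k] tri_double[of "- k"] by (simp add: algebra_simps)
  moreover have "tri (2 * (- 1 - k) + 1) = 3 * tri k + tri (- k)" for k
    using tri_double[of "2 * (- 1 - k) + 1"] tri_double[of k] tri_double[of "- k"] by (simp add: algebra_simps)
  moreover have "bij (\<lambda>k :: int. - 1 - k)"
    by (rule involuntory_imp_bij) simp
  have "qseries (\<lambda>_. 1) (\<lambda>k. tri (2 * k + 1)) = qseries (\<lambda>_. 1) (\<lambda>k. tri (2 * (- 1 - k) + 1))"
    using qseries_reindex[OF \<open>bij _\<close>, of "\<lambda>_. 1" "\<lambda>k. tri (2 * k + 1)"] by (simp only: comp_def)
  ultimately show ?thesis
    using qseries_residues[OF zero_less_numeral tri_fibre, of "\<lambda>_. 1" "num.Bit0 num.One"]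
    by (simp add: numeral_2_eq_2 psi_def)
qed

lemma theta_dissect: "theta 1 = fps_dilate 4 (theta 1) + 2 * fps_X * fps_dilate 8 psi"
proof -
  have "tri (2 * k) + tri (- (2 * k)) = 4 * (tri k + tri (- k))" for k
    using tri_add_tri_uminus[of "2 * k"] tri_add_tri_uminus[of k] by simp
  moreover have "tri (2 * k + 1) + tri (- (2 * k + 1)) = 8 * tri k + 1" for k
    using tri_add_tri_uminus[of "2 * k + 1"] tri_double[of k] by (simp add: algebra_simps)
  ultimately have "theta 1 = qseries (\<lambda>_. 1) (\<lambda>k. 4 * (tri k + tri (- k))) + qseries (\<lambda>_. 1) (\<lambda>k. 8 * tri k + 1)"
    using qseries_residues[OF zero_less_numeral square_fibre, of "\<lambda>_. 1" "num.Bit0 num.One"]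
    by (simp add: theta_def numeral_2_eq_2)
  also have "\<dots> = fps_dilate 4 (theta 1) + fps_X * fps_dilate 8 (2 * psi)"
    by (simp only: qseries_shift qseries_dilate[OF zero_less_numeral] qseries_tri) (simp add: theta_def)
  finally show ?thesis by (simp add: fps_dilate_simps mult_ac)
qed

text \<open>Rotation of the square lattice: pairs with even sum are (u+v, u-v), with squares adding
  up to 2u^2 + 2v^2; the others are (u+v+1, u-v) and give 4 \<open>tri u\<close> + 4
  \<open>tri v\<close> + 1. A sign \<sigma> affects only the second class. The coefficient 4 is the
  square of the 2 in \<open>qseries_tri\<close>.\<close>

lemma theta_square:
  assumes "\<sigma> * \<sigma> = 1"
  shows "theta \<sigma> ^ 2 = fps_dilate 2 (theta 1) ^ 2 + fps_const \<sigma> * (4 * fps_X * fps_dilate 4 psi ^ 2)"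
proof -
  define sq where "sq n = tri n + tri (- n)" for n
  define e where "e = (\<lambda>(k, l). sq k + sq l)"
  have sq: "int (sq n) = n * n" for n unfolding sq_def by (rule tri_add_tri_uminus)
  have fib: "finite {k. sq k = n}" for n unfolding sq_def by (rule square_fibre)
  define g h where "g = (\<lambda>(u, v). (u + v, u - v :: int))" and "h = (\<lambda>(u, v). (u + v + 1, u - v :: int))"
  have "theta \<sigma> ^ 2 = qseries (\<lambda>(k, l). \<sigma> ^ sq k * \<sigma> ^ sq l) e"
    unfolding theta_def power2_eq_square e_def sq_def[symmetric] by (rule qseries_mult) (rule fib)+
  also have "(\<lambda>(k, l). \<sigma> ^ sq k * \<sigma> ^ sq l) = (\<lambda>x. \<sigma> ^ e x)"
    by (auto simp: e_def power_add)
  also have "qseries (\<lambda>x. \<sigma> ^ e x) e = qseries ((\<lambda>x. \<sigma> ^ e x) \<circ> g) (e \<circ> g) + qseries ((\<lambda>x. \<sigma> ^ e x) \<circ> h) (e \<circ> h)"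
  proof (rule qseries_split)
    fix n
    have "{k. e k = n} \<subseteq> (\<Union>i\<le>n. {k. sq k = i}) \<times> (\<Union>i\<le>n. {k. sq k = i})"
      by (auto simp: e_def)
    moreover have "finite \<dots>" using fib by auto
    ultimately show "finite {k. e k = n}" by (rule finite_subset)
  next
    show "inj g" "inj h" by (auto simp: g_def h_def inj_on_def)
    have "False" if "g x = h y" for x y
    proof -
      obtain u v u' v' where "x = (u, v)" "y = (u', v')" by fastforce
      then have "2 * u = 2 * u' + 1" using that by (auto simp: g_def h_def)
      then show False by presburger
    qed
    then show "range g \<inter> range h = {}" by blast
    have "(k, l) \<in> range g \<union> range h" for k l
    proof (cases "even (k + l)")
      case True
      then have "(k, l) = g ((k + l) div 2, (k - l) div 2)" by (auto simp: g_def elim!: evenE) presburger+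
      then show ?thesis by blast
    next
      case False
      then have "(k, l) = h ((k + l - 1) div 2, (k - l - 1) div 2)" by (auto simp: h_def elim!: oddE)
      then show ?thesis by blast
    qed
    then show "range g \<union> range h = UNIV" by auto
  qed
  also have "e \<circ> g = (\<lambda>(u, v). 2 * sq u + 2 * sq v)"
  proof
    fix x :: "int \<times> int"
    obtain u v where x: "x = (u, v)" by fastforce
    have "int (sq (u + v) + sq (u - v)) = int (2 * sq u + 2 * sq v)"
      by (simp add: sq algebra_simps)
    then show "(e \<circ> g) x = (case x of (u, v) \<Rightarrow> 2 * sq u + 2 * sq v)"
      unfolding of_nat_eq_iff by (simp add: x e_def g_def)
  qed
  also have "e \<circ> h = (\<lambda>x. (case x of (u, v) \<Rightarrow> 4 * tri u + 4 * tri v) + 1)"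
  proof
    fix x :: "int \<times> int"
    obtain u v where x: "x = (u, v)" by fastforce
    have "int (sq (u + v + 1) + sq (u - v)) = int (4 * tri u + 4 * tri v + 1)"
      using tri_double[of u] tri_double[of v] by (simp add: sq algebra_simps)
    then show "(e \<circ> h) x = (case x of (u, v) \<Rightarrow> 4 * tri u + 4 * tri v) + 1"
      unfolding of_nat_eq_iff by (simp add: x e_def h_def)
  qed
  also have "(\<lambda>x. \<sigma> ^ e x) \<circ> g = (\<lambda>(u, v). 1 * 1)"
  proof -
    have "\<sigma> ^ (2 * k + 2 * l) = 1" for k l
      using assms by (simp add: power_add power_mult power2_eq_square)
    then show ?thesis using \<open>e \<circ> g = _\<close> by (auto simp: fun_eq_iff)
  qed
  also have "(\<lambda>x. \<sigma> ^ e x) \<circ> h = (\<lambda>x. \<sigma> * (case x of (u, v) \<Rightarrow> 1 * 1))"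
  proof -
    have "\<sigma> ^ (4 * k) = 1" for k
      using assms by (simp add: power_mult power4_eq_xxxx mult.assoc)
    then have "\<sigma> ^ (4 * k + 4 * l + 1) = \<sigma>" for k l by (simp add: power_add)
    then show ?thesis using \<open>e \<circ> h = _\<close> by (auto simp: fun_eq_iff)
  qed
  also have "qseries (\<lambda>(u, v). 1 * 1) (\<lambda>(u, v). 2 * sq u + 2 * sq v) =
      qseries (\<lambda>_. 1) (\<lambda>u. 2 * sq u) * qseries (\<lambda>_. 1) (\<lambda>u. 2 * sq u)"
  proof (rule qseries_mult[symmetric])
    show "finite {u. 2 * sq u = n}" for n
    proof (rule finite_int_fibre)
      show "\<bar>u\<bar> \<le> int (2 * sq u) + 1" for u using square_ge[of u] by (simp flip: sq_def)
    qed
    then show "finite {u. 2 * sq u = n}" for n .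
  qed
  also have "\<dots> = fps_dilate 2 (theta 1) ^ 2"
    by (simp only: qseries_dilate[OF zero_less_numeral]) (simp add: theta_def sq_def power2_eq_square)
  also have "qseries (\<lambda>x. \<sigma> * (case x of (u, v) \<Rightarrow> 1 * 1)) (\<lambda>x. (case x of (u, v) \<Rightarrow> 4 * tri u + 4 * tri v) + 1) =
      fps_const \<sigma> * (fps_X * qseries (\<lambda>(u, v). 1 * 1) (\<lambda>(u, v). 4 * tri u + 4 * tri v))"
    by (simp only: qseries_cmult qseries_shift power_one_right)
  also have "qseries (\<lambda>(u, v). 1 * 1) (\<lambda>(u, v). 4 * tri u + 4 * tri v) =
      qseries (\<lambda>_. 1) (\<lambda>u. 4 * tri u) * qseries (\<lambda>_. 1) (\<lambda>u. 4 * tri u)"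
  proof (rule qseries_mult[symmetric])
    show "finite {u. 4 * tri u = n}" for n
    proof (rule finite_int_fibre)
      show "\<bar>u\<bar> \<le> int (4 * tri u) + 1" for u using tri_ge[of u] by simp
    qed
    then show "finite {u. 4 * tri u = n}" for n .
  qed
  also have "\<dots> = 4 * fps_dilate 4 psi ^ 2"
    by (simp only: qseries_dilate[OF zero_less_numeral] qseries_tri) (simp add: fps_dilate_simps power2_eq_square)
  finally show ?thesis by (simp add: mult_ac)
qed

text \<open>Jacobi's quartic identity, as the difference of the squares of the two instances of
  \<open>theta_square\<close>; the mixed term is rewritten by \<psi>(q^2)^2 = \<phi>(q^2)
  \<psi>(q^4).\<close>

lemma theta_fourth_power: "theta 1 ^ 4 = theta (-1) ^ 4 + 16 * fps_X * fps_dilate 2 psi ^ 4"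
proof -
  have p: "theta 1 ^ 2 = fps_dilate 2 (theta 1) ^ 2 + 4 * fps_X * fps_dilate 4 psi ^ 2"
    using theta_square[of 1] by simp
  have m: "theta (-1) ^ 2 = fps_dilate 2 (theta 1) ^ 2 - 4 * fps_X * fps_dilate 4 psi ^ 2"
    using theta_square[of "-1"] by (simp flip: fps_const_neg)
  have "fps_dilate 2 psi ^ 2 = fps_dilate 2 (theta 1) * fps_dilate 4 psi"
    using arg_cong[OF psi_square, of "fps_dilate 2"] by (simp add: fps_dilate_simps)
  then have "(fps_dilate 2 psi ^ 2) ^ 2 = (fps_dilate 2 (theta 1) * fps_dilate 4 psi) ^ 2" by simp
  moreover have "(theta 1 ^ 2) ^ 2 - (theta (-1) ^ 2) ^ 2 = 16 * fps_X * (fps_dilate 2 (theta 1) * fps_dilate 4 psi) ^ 2"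
    unfolding p m by (simp add: algebra_simps power2_eq_square)
  ultimately show ?thesis by (simp add: algebra_simps flip: power_mult)
qed

section \<open>Trisection of Jacobi's series\<close>

definition cubic_part :: "int fps"
  where "cubic_part = qseries (\<lambda>n. (-1) ^ (tri n + tri (- n)) * (6 * n + 1)) (\<lambda>n. 2 * tri n + tri (- n))"

text \<open>For n = 3k the exponent is three times the pentagonal number k(3k+1)/2, and n = 3k+2
  gives the same after k to -1-k; the coefficients 3k and 3k+1 add up to 6k+1. The class n = 3k+1
  has exponent 9 \<open>tri k\<close> + 1 and reproduces Jacobi's series.\<close>

lemma jacobi_cube_dissect:
  "jacobi_cube = fps_dilate 3 cubic_part - 3 * fps_X * fps_dilate 9 jacobi_cube"
proof -
  have bij: "bij (\<lambda>k :: int. - 1 - k)"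
    by (rule involuntory_imp_bij) simp
  define c where "c n = (if even n then 1 else -1 :: int)" for n :: int
  have c: "(-1) ^ (tri n + tri (- n)) = c n" for n by (simp add: c_def minus_one_power_tri)
  \<comment> \<open>This series cancels in pairs n, -1-n. It disposes of the constant part of the
    coefficient -(3k+1) in the class n = 3k+1.\<close>
  have "qseries c tri = qseries (\<lambda>k. c (- 1 - k)) (\<lambda>k. tri (- 1 - k))"
    using qseries_reindex[OF bij, of c tri] by (simp only: comp_def)
  moreover have "tri (- 1 - k) = tri k" for k
    using tri_double[of "- 1 - k"] tri_double[of k] by (simp add: algebra_simps)
  moreover have "c (- 1 - k) = - c k" for k by (simp add: c_def)
  ultimately have zero: "qseries c tri = 0" by (simp add: qseries_uminus)
  have r0: "tri (3 * k) = 3 * (2 * tri k + tri (- k))" for k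
    using tri_double[of "3 * k"] tri_double[of k] tri_double[of "- k"] by (simp add: algebra_simps)
  have r1: "tri (3 * k + 1) = 9 * tri k + 1" for k
    using tri_double[of "3 * k + 1"] tri_double[of k] by (simp add: algebra_simps)
  have r2: "tri (3 * (- 1 - k) + 2) = 3 * (2 * tri k + tri (- k))" for k
    using tri_double[of "3 * (- 1 - k) + 2"] tri_double[of k] tri_double[of "- k"] by (simp add: algebra_simps)
  have "jacobi_cube = qseries (\<lambda>k. c (3 * k) * (3 * k)) (\<lambda>k. tri (3 * k)) +
      qseries (\<lambda>k. c (3 * k + 1) * (3 * k + 1)) (\<lambda>k. tri (3 * k + 1)) +
      qseries (\<lambda>k. c (3 * k + 2) * (3 * k + 2)) (\<lambda>k. tri (3 * k + 2))"
    using qseries_residues[OF zero_less_numeral tri_fibre, of "\<lambda>n. c n * n" "num.Bit1 num.One"]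
    unfolding jacobi_cube_def c by (simp add: numeral_3_eq_3 add.assoc)
  also have "qseries (\<lambda>k. c (3 * k + 2) * (3 * k + 2)) (\<lambda>k. tri (3 * k + 2)) =
      qseries (\<lambda>k. c (3 * (- 1 - k) + 2) * (3 * (- 1 - k) + 2)) (\<lambda>k. tri (3 * (- 1 - k) + 2))"
    using qseries_reindex[OF bij, of "\<lambda>k. c (3 * k + 2) * (3 * k + 2)" "\<lambda>k. tri (3 * k + 2)"] by (simp only: comp_def)
  also have "(\<lambda>k. c (3 * k + 1) * (3 * k + 1)) = (\<lambda>k. (- 3) * (c k * k) + - c k)"
    by (auto simp: c_def algebra_simps)
  also have "qseries \<dots> (\<lambda>k. tri (3 * k + 1)) = - 3 * fps_X * fps_dilate 9 jacobi_cube"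
    unfolding r1 qseries_shift qseries_dilate[OF zero_less_numeral] qseries_add qseries_uminus zero qseries_cmult
    unfolding jacobi_cube_def c by (simp add: fps_dilate_simps numeral_fps_const[symmetric] mult_ac flip: fps_const_neg)
  also have "(\<lambda>k. c (3 * k) * (3 * k)) = (\<lambda>k. c k * (3 * k))" by (auto simp: c_def)
  also have "(\<lambda>k. c (3 * (- 1 - k) + 2) * (3 * (- 1 - k) + 2)) = (\<lambda>k. c k * (3 * k + 1))"
    by (auto simp: c_def algebra_simps)
  finally have "jacobi_cube = qseries (\<lambda>k. c k * (3 * k) + c k * (3 * k + 1)) (\<lambda>k. 3 * (2 * tri k + tri (- k))) -
      3 * fps_X * fps_dilate 9 jacobi_cube"
    unfolding r0 r2 qseries_add by (simp only: diff_conv_add_uminus mult_minus_left add_ac)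
  also have "(\<lambda>k. c k * (3 * k) + c k * (3 * k + 1)) = (\<lambda>k. c k * (6 * k + 1))"
    by (auto simp: algebra_simps)
  finally show ?thesis unfolding qseries_dilate[OF zero_less_numeral] cubic_part_def c .
qed

subsection \<open>The even part of the generating function\<close>

lemma fps_series_tendsto:
  fixes f :: "nat \<Rightarrow> int fps"
  assumes "\<And>n. fps_X ^ n dvd f n"
  shows "(\<lambda>N. \<Sum>n<N. f n) \<longlonglongrightarrow> Abs_fps (\<lambda>m. \<Sum>n\<le>m. fps_nth (f n) m)"
proof (rule tendsto_fpsI)
  fix m
  show "\<forall>\<^sub>F N in sequentially. fps_nth (\<Sum>n<N. f n) m = fps_nth (Abs_fps (\<lambda>m. \<Sum>n\<le>m. fps_nth (f n) m)) m"
    using eventually_gt_at_top[of m]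
  proof eventually_elim
    case (elim N)
    have "fps_nth (f n) m = 0" if "n \<in> {..<N} - {..m}" for n
      using assms[of n] that by (simp add: fps_X_power_dvd_iff)
    then have "(\<Sum>n<N. fps_nth (f n) m) = (\<Sum>n\<le>m. fps_nth (f n) m)"
      using elim by (intro sum.mono_neutral_right) auto
    then show ?case by (simp add: fps_sum_nth)
  qed
qed

definition mock_denom :: "int fps \<Rightarrow> nat \<Rightarrow> int fps"
  where "mock_denom g n = (\<Prod>i<n. 1 - g * fps_X ^ (2 * i + 1))"

text \<open>The parameter is itself a series in q and no new variable: the iteration runs through g
  = 1, q^2, q^4, ... and their negatives, with limit 0.\<close>

definition mock_term :: "int fps \<Rightarrow> nat \<Rightarrow> int fps"
  where "mock_term g n = fps_X ^ n\<^sup>2 * (\<Prod>i<n. g + fps_X ^ (2 * i + 1)) * fps_right_inverse (mock_denom g n) 1"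

definition mock_sum :: "int fps \<Rightarrow> int fps"
  where "mock_sum g = Abs_fps (\<lambda>m. \<Sum>n\<le>m. fps_nth (mock_term g n) m)"

lemma mock_denom_nth_0: "fps_nth (mock_denom g n) 0 = 1"
  by (simp add: mock_denom_def fps_prod_nth_0 fps_mult_nth_0)

lemma mock_denom_nonzero: "mock_denom g n \<noteq> 0"
  using mock_denom_nth_0[of g n] by auto

lemma mock_denom_inverse: "mock_denom g n * fps_right_inverse (mock_denom g n) 1 = 1"
  by (rule fps_right_inverse) (simp add: mock_denom_nth_0)

lemma mock_term_denom: "mock_term g n * mock_denom g n = fps_X ^ n\<^sup>2 * (\<Prod>i<n. g + fps_X ^ (2 * i + 1))"
  unfolding mock_term_def using mock_denom_inverse[of g n] by (simp add: mult_ac)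

lemma mock_term_0 [simp]: "mock_term g 0 = 1"
  using mock_term_denom[of g 0] by (simp add: mock_denom_def)

lemma power_square_Suc: "x ^ (Suc n)\<^sup>2 = x ^ n\<^sup>2 * (x ^ (2 * n + 1) :: 'a::monoid_mult)"
  unfolding power_add[symmetric] by (rule arg_cong[where f = "power x"]) (simp add: power2_eq_square)

lemma mock_term_Suc:
  "mock_term g (Suc n) * (1 - g * fps_X ^ (2 * n + 1)) = mock_term g n * fps_X ^ (2 * n + 1) * (g + fps_X ^ (2 * n + 1))"
proof -
  have "mock_denom g n * (mock_term g (Suc n) * (1 - g * fps_X ^ (2 * n + 1))) = mock_term g (Suc n) * mock_denom g (Suc n)"
    by (simp add: mock_denom_def mult_ac)
  also have "\<dots> = mock_term g n * mock_denom g n * (fps_X ^ (2 * n + 1) * (g + fps_X ^ (2 * n + 1)))"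
    unfolding mock_term_denom power_square_Suc by (simp add: mult_ac)
  finally have "mock_denom g n * (mock_term g (Suc n) * (1 - g * fps_X ^ (2 * n + 1))) =
      mock_denom g n * (mock_term g n * fps_X ^ (2 * n + 1) * (g + fps_X ^ (2 * n + 1)))"
    by (simp only: mult_ac)
  then show ?thesis using mock_denom_nonzero by (simp only: mult_cancel_left) simp
qed

lemma mock_term_dvd: "fps_X ^ n dvd mock_term g n"
proof -
  have "fps_X ^ n dvd (fps_X :: int fps) ^ n\<^sup>2" by (intro le_imp_power_dvd) (simp add: power2_eq_square)
  then show ?thesis by (simp add: mock_term_def mult.assoc dvd_mult2)
qed

lemma mock_sum_tendsto: "(\<lambda>N. \<Sum>n<N. mock_term g n) \<longlonglongrightarrow> mock_sum g"
  unfolding mock_sum_def by (rule fps_series_tendsto) (rule mock_term_dvd)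

text \<open>Passing from g to g q^2 moves both products by one factor. Term n+1 at g q^2 and term n
  at g thus differ only by a power of q, by (1 + gq)(1 - gq) from the lower ends, and by two
  denominators at the upper end.\<close>

lemma mock_term_shift:
  "mock_term (g * fps_X ^ 2) (Suc n) * (1 - g * fps_X ^ (2 * n + 1)) * (1 - g * fps_X ^ (2 * n + 3)) =
    mock_term g n * (1 - g ^ 2 * fps_X ^ 2) * fps_X ^ (4 * n + 2)"
proof (induction n)
  case 0
  have "mock_term (g * fps_X ^ 2) (Suc 0) * (1 - g * fps_X ^ 3) = fps_X * (g * fps_X ^ 2 + fps_X)"
    using mock_term_Suc[of "g * fps_X ^ 2" 0] by (simp add: power2_eq_square power3_eq_cube mult_ac)
  then have "mock_term (g * fps_X ^ 2) (Suc 0) * (1 - g * fps_X ^ 3) * (1 - g * fps_X) =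
      fps_X * (g * fps_X ^ 2 + fps_X) * (1 - g * fps_X)" by simp
  then show ?case by (simp add: power2_eq_square algebra_simps)
next
  case (Suc n)
  define x where "x = (fps_X :: int fps) ^ (2 * n + 1)"
  define X2 where "X2 = (fps_X :: int fps) ^ 2"
  define d where "d = 1 - g * x"
  have p: "fps_X ^ (2 * n + 3) = x * X2" "fps_X ^ (2 * Suc n + 1) = x * X2" "fps_X ^ (2 * Suc n + 3) = x * X2 * X2"
    "fps_X ^ (4 * n + 2) = x * x" "fps_X ^ (4 * Suc n + 2) = x * X2 * (x * X2)"
    unfolding x_def X2_def power_add[symmetric] by (rule arg_cong[where f = "power fps_X"], simp)+
  have IH: "mock_term (g * X2) (Suc n) * d * (1 - g * (x * X2)) = mock_term g n * (1 - g\<^sup>2 * X2) * (x * x)"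
    using Suc by (simp only: p d_def flip: x_def X2_def)
  have r1: "mock_term (g * X2) (Suc (Suc n)) * (1 - g * (x * X2 * X2)) =
      mock_term (g * X2) (Suc n) * (x * X2) * (g * X2 + x * X2)"
    using mock_term_Suc[of "g * X2" "Suc n"] unfolding p by (simp add: mult_ac)
  have r2: "mock_term g (Suc n) * d = mock_term g n * x * (g + x)"
    using mock_term_Suc[of g n] by (simp only: d_def flip: x_def)
  have "d * (mock_term (g * X2) (Suc (Suc n)) * (1 - g * (x * X2)) * (1 - g * (x * X2 * X2))) =
      (mock_term (g * X2) (Suc (Suc n)) * (1 - g * (x * X2 * X2))) * d * (1 - g * (x * X2))"
    by (simp only: mult_ac)
  also have "\<dots> = (mock_term (g * X2) (Suc n) * d * (1 - g * (x * X2))) * ((x * X2) * (g * X2 + x * X2))"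
    unfolding r1 by (simp only: mult_ac)
  also have "\<dots> = (mock_term g n * x * (g + x)) * (1 - g\<^sup>2 * X2) * (x * X2 * X2 * x)"
    unfolding IH by (simp add: algebra_simps)
  also have "\<dots> = d * (mock_term g (Suc n) * (1 - g\<^sup>2 * X2) * (x * X2 * (x * X2)))"
    unfolding r2[symmetric] by (simp only: mult_ac)
  finally have "d * (mock_term (g * X2) (Suc (Suc n)) * (1 - g * (x * X2)) * (1 - g * (x * X2 * X2))) =
      d * (mock_term g (Suc n) * (1 - g\<^sup>2 * X2) * (x * X2 * (x * X2)))" .
  moreover have "d \<noteq> 0"
  proof
    assume "d = 0"
    moreover have "fps_nth d 0 = 1" by (simp add: d_def x_def fps_mult_nth_0)
    ultimately show False by simp
  qed
  ultimately show ?case unfolding p X2_def[symmetric] by simp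
qed

text \<open>Telescoping with the certificate u(n) = \<open>mock_term g n\<close> / (1 - g q^(2n+1)),
  which tends to 0. The initial term at g q^2 has no partner and is subtracted as 1; the boundary
  value at n = 0 contributes 1 + gq.\<close>

lemma mock_sum_shift:
  "(1 - g\<^sup>2 * fps_X\<^sup>2) * mock_sum g = (1 + g\<^sup>2 * fps_X\<^sup>2) * (mock_sum (g * fps_X\<^sup>2) - 1) + (1 + g * fps_X)"
proof -
  define c where "c = g\<^sup>2 * fps_X\<^sup>2"
  define x where "x n = (fps_X :: int fps) ^ (2 * n + 1)" for n
  define d where "d n = 1 - g * x n" for n
  define e where "e n = fps_right_inverse (d n) 1" for n
  define u where "u n = mock_term g n * e n" for n
  have x_Suc: "x (Suc n) = x n * fps_X\<^sup>2" for n by (simp add: x_def power2_eq_square mult_ac)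
  have de: "d n * e n = 1" for n
    unfolding e_def by (rule fps_right_inverse) (simp add: d_def x_def fps_mult_nth_0)
  have step: "(1 - c) * mock_term g n - (1 + c) * mock_term (g * fps_X\<^sup>2) (Suc n) = (1 - c) * (u n - u (Suc n))" for n
  proof -
    have s1: "mock_term g (Suc n) * d n = mock_term g n * x n * (g + x n)"
      using mock_term_Suc[of g n] by (simp only: d_def x_def)
    have "mock_term g (Suc n) = (mock_term g (Suc n) * d n) * e n" using de[of n] by (simp add: mult.assoc)
    then have u1: "u (Suc n) = mock_term g n * x n * (g + x n) * e n * e (Suc n)" unfolding u_def s1 by simp
    have "fps_X ^ (2 * n + 3) = x (Suc n)" "fps_X ^ (4 * n + 2) = x n * x n"
      by (simp_all add: x_def numeral_3_eq_3 flip: power_add)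
    then have s2: "mock_term (g * fps_X\<^sup>2) (Suc n) * d n * d (Suc n) = mock_term g n * (1 - c) * (x n * x n)"
      using mock_term_shift[of g n] by (simp only: d_def c_def flip: x_def)
    have "mock_term (g * fps_X\<^sup>2) (Suc n) = (mock_term (g * fps_X\<^sup>2) (Suc n) * d n * d (Suc n)) * e n * e (Suc n)"
      using de[of n] de[of "Suc n"] by (metis (no_types, opaque_lifting) mult.assoc mult.commute mult_1_right)
    then have m1: "mock_term (g * fps_X\<^sup>2) (Suc n) = mock_term g n * (1 - c) * (x n * x n) * e n * e (Suc n)"
      unfolding s2 .
    have m0: "mock_term g n = mock_term g n * (d n * d (Suc n)) * e n * e (Suc n)"
      using de[of n] de[of "Suc n"] by (metis (no_types, opaque_lifting) mult.assoc mult.commute mult_1_right)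
    have u0: "u n = mock_term g n * d (Suc n) * e n * e (Suc n)"
      unfolding u_def using de[of "Suc n"] by (metis (no_types, opaque_lifting) mult.assoc mult.commute mult_1_right)
    \<comment> \<open>Once the common factors are taken out, the telescoping relation is this
      polynomial identity; c = g^2 q^2 is the value for which the terms quadratic in both g and x
      cancel.\<close>
    have key: "d n * d (Suc n) - (1 + c) * (x n * x n) = d (Suc n) - x n * (g + x n)"
      unfolding d_def x_Suc c_def by (simp add: algebra_simps power2_eq_square)
    have "(1 - c) * mock_term g n - (1 + c) * mock_term (g * fps_X\<^sup>2) (Suc n) =
        (1 - c) * mock_term g n * e n * e (Suc n) * (d n * d (Suc n) - (1 + c) * (x n * x n))"
      by (subst m0, subst m1) (simp add: algebra_simps)
    also have "\<dots> = (1 - c) * (u n - u (Suc n))"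
      unfolding key u0 u1 by (simp add: algebra_simps)
    finally show ?thesis .
  qed
  have partial: "(1 - c) * (\<Sum>n<N. mock_term g n) - (1 + c) * ((\<Sum>n<Suc N. mock_term (g * fps_X\<^sup>2) n) - 1) =
      (1 - c) * (u 0 - u N)" for N
  proof -
    have "(\<Sum>n<N. (1 - c) * mock_term g n - (1 + c) * mock_term (g * fps_X\<^sup>2) (Suc n)) =
        (1 - c) * (\<Sum>n<N. u n - u (Suc n))"
      unfolding step by (rule sum_distrib_left[symmetric])
    also have "(\<Sum>n<N. u n - u (Suc n)) = u 0 - u N"
      by (rule sum_lessThan_telescope')
    finally show ?thesis
      by (subst sum.lessThan_Suc_shift) (simp add: sum_subtractf sum_distrib_left)
  qed
  have "(1 - c) * (\<Sum>n<N. mock_term g n) + (1 - c) * u N =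
      (1 + c) * ((\<Sum>n<Suc N. mock_term (g * fps_X\<^sup>2) n) + (- 1)) + (1 - c) * u 0" for N
    using partial[of N] by (simp add: algebra_simps del: sum.lessThan_Suc)
  moreover have "(\<lambda>N. (1 - c) * (\<Sum>n<N. mock_term g n) + (1 - c) * u N) \<longlonglongrightarrow> (1 - c) * mock_sum g + (1 - c) * 0"
  proof (intro fps_tendsto_add fps_tendsto_mult tendsto_const mock_sum_tendsto)
    have "fps_X ^ N dvd u N - 0" for N
      using mock_term_dvd[of N g] by (simp add: u_def)
    then show "u \<longlonglongrightarrow> 0"
      by (rule fps_tendsto_cong_dvd[OF tendsto_const])
  qed
  moreover have "(\<lambda>N. (1 + c) * ((\<Sum>n<Suc N. mock_term (g * fps_X\<^sup>2) n) + (- 1)) + (1 - c) * u 0) \<longlonglongrightarrow>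
      (1 + c) * (mock_sum (g * fps_X\<^sup>2) + (- 1)) + (1 - c) * u 0"
    by (intro fps_tendsto_add fps_tendsto_mult tendsto_const LIMSEQ_Suc[OF mock_sum_tendsto])
  ultimately have "(1 - c) * mock_sum g = (1 + c) * (mock_sum (g * fps_X\<^sup>2) - 1) + (1 - c) * u 0"
    using LIMSEQ_unique by fastforce
  moreover have "(1 - c) * u 0 = 1 + g * fps_X"
  proof -
    have "1 - c = (1 + g * fps_X) * d 0" by (simp add: c_def d_def x_def algebra_simps power2_eq_square)
    then show ?thesis using de[of 0] by (simp add: u_def mult.assoc)
  qed
  ultimately show ?thesis by (simp add: c_def)
qed

definition mock_bilateral :: "int fps \<Rightarrow> int fps"
  where "mock_bilateral g = mock_sum g + mock_sum (- g) - 1"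

text \<open>The inhomogeneous term gq is odd in g and cancels between g and -g. The -1, which counts
  the summand n = 0 once, makes the constants match as well.\<close>

lemma mock_bilateral_shift:
  "(1 - g\<^sup>2 * fps_X\<^sup>2) * mock_bilateral g = (1 + g\<^sup>2 * fps_X\<^sup>2) * mock_bilateral (g * fps_X\<^sup>2)"
proof -
  have "(1 - g\<^sup>2 * fps_X\<^sup>2) * mock_bilateral g =
      (1 - g\<^sup>2 * fps_X\<^sup>2) * mock_sum g + (1 - (- g)\<^sup>2 * fps_X\<^sup>2) * mock_sum (- g) - (1 - g\<^sup>2 * fps_X\<^sup>2)"
    by (simp add: mock_bilateral_def algebra_simps)
  then show ?thesis
    unfolding mock_sum_shift by (simp add: mock_bilateral_def algebra_simps)
qed

lemma mock_bilateral_iterate: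
  "(\<Prod>i<k. 1 - fps_X ^ (4 * i + 2)) * mock_bilateral 1 =
    (\<Prod>i<k. 1 + fps_X ^ (4 * i + 2)) * mock_bilateral (fps_X ^ (2 * k))"
proof (induction k)
  case (Suc k)
  have "(fps_X ^ (2 * k))\<^sup>2 * fps_X\<^sup>2 = (fps_X ^ (4 * k + 2) :: int fps)"
    "fps_X ^ (2 * k) * fps_X\<^sup>2 = (fps_X ^ (2 * Suc k) :: int fps)"
    by (simp_all flip: power_mult power_add)
  then have "(1 - fps_X ^ (4 * k + 2)) * mock_bilateral (fps_X ^ (2 * k)) =
      (1 + fps_X ^ (4 * k + 2)) * mock_bilateral (fps_X ^ (2 * Suc k))"
    using mock_bilateral_shift[of "fps_X ^ (2 * k)"] by (simp only:)
  then have "(\<Prod>i<k. 1 + fps_X ^ (4 * i + 2)) * ((1 - fps_X ^ (4 * k + 2)) * mock_bilateral (fps_X ^ (2 * k))) =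
      (\<Prod>i<k. 1 + fps_X ^ (4 * i + 2)) * ((1 + fps_X ^ (4 * k + 2)) * mock_bilateral (fps_X ^ (2 * Suc k)))"
    by (simp only:)
  moreover have "(1 - fps_X ^ (4 * k + 2)) * ((\<Prod>i<k. 1 - fps_X ^ (4 * i + 2)) * mock_bilateral 1) =
      (1 - fps_X ^ (4 * k + 2)) * ((\<Prod>i<k. 1 + fps_X ^ (4 * i + 2)) * mock_bilateral (fps_X ^ (2 * k)))"
    by (simp only: Suc)
  ultimately show ?case by (simp only: prod.lessThan_Suc mult_ac)
qed simp

text \<open>For small g the denominators become 1 and the numerator becomes q^(1+3+...+(2n-1)) =
  q^(n^2), which doubles the exponent.\<close>

lemma mock_term_dcong:
  assumes "fps_X ^ k dvd g"
  shows "dcong (fps_X ^ k) (mock_term g n) (fps_X ^ (2 * n\<^sup>2))"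
proof -
  have g: "dcong (fps_X ^ k) g 0" using assms by (simp add: dcong_def)
  have "dcong (fps_X ^ k) (mock_denom g n) 1"
    unfolding mock_denom_def
  proof (induction n)
    case (Suc n)
    have "dcong (fps_X ^ k) (1 - g * fps_X ^ (2 * n + 1)) 1"
      using assms by (simp add: dcong_def)
    from dcong_mult[OF Suc this] show ?case by simp
  qed simp
  from dcong_mult[OF dcong_sym[OF this] dcong_refl[of _ "fps_right_inverse (mock_denom g n) 1"]]
  have inv: "dcong (fps_X ^ k) (fps_right_inverse (mock_denom g n) 1) 1"
    by (simp add: mock_denom_inverse)
  have num: "dcong (fps_X ^ k) (\<Prod>i<n. g + fps_X ^ (2 * i + 1)) (fps_X ^ n\<^sup>2)"
  proof (induction n)
    case (Suc n)
    from dcong_mult[OF Suc dcong_add[OF g dcong_refl[of _ "fps_X ^ (2 * n + 1)"]]]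
    show ?case by (simp only: power_square_Suc prod.lessThan_Suc add_0)
  qed simp
  have "dcong (fps_X ^ k) (mock_term g n) (fps_X ^ n\<^sup>2 * fps_X ^ n\<^sup>2 * 1)"
    unfolding mock_term_def by (intro dcong_mult dcong_refl num inv)
  then show ?thesis by (simp add: power_add mult_2)
qed

lemma mock_sum_dcong:
  assumes "fps_X ^ k dvd g"
  shows "dcong (fps_X ^ k) (mock_sum g) (mock_sum 0)"
proof -
  have "fps_nth (mock_term g n) i = fps_nth (mock_term 0 n) i" if "i < k" for i n
    using dcong_trans[OF mock_term_dcong[OF assms, of n] dcong_sym[OF mock_term_dcong[of k 0 n, OF dvd_0_right]]] that
    by (simp add: dcong_def fps_X_power_dvd_iff)
  then show ?thesis by (simp add: dcong_def fps_X_power_dvd_iff mock_sum_def)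
qed

lemma mock_bilateral_0: "mock_bilateral 0 = fps_dilate 2 (theta 1)"
proof -
  define t where "t n = (fps_X :: int fps) ^ (2 * (tri n + tri (- n)))" for n
  have "(\<lambda>N. \<Sum>n = - int N..int N. fps_const 1 * fps_X ^ (2 * (tri n + tri (- n)))) \<longlonglongrightarrow>
      qseries (\<lambda>_. 1) (\<lambda>n. 2 * (tri n + tri (- n)))"
  proof (rule qseries_tendsto)
    show "\<bar>n\<bar> \<le> int (2 * (tri n + tri (- n))) + 1" for n using square_ge[of n] by simp
  qed
  then have lim: "(\<lambda>N. \<Sum>n = - int N..int N. t n) \<longlonglongrightarrow> fps_dilate 2 (theta 1)"
    by (simp only: qseries_dilate[OF zero_less_numeral]) (simp add: theta_def t_def)
  have mock: "mock_term 0 n = t (int n)" for n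
  proof -
    have "mock_term 0 n = fps_X ^ (2 * n\<^sup>2)"
    proof (rule fps_ext)
      fix m
      have "dcong (fps_X ^ Suc m) (mock_term 0 n) (fps_X ^ (2 * n\<^sup>2))" by (rule mock_term_dcong) simp
      then show "fps_nth (mock_term 0 n) m = fps_nth (fps_X ^ (2 * n\<^sup>2)) m"
        unfolding dcong_def fps_X_power_dvd_iff by simp
    qed
    moreover have "tri (int n) + tri (- int n) = n\<^sup>2"
      using tri_add_tri_uminus[of "int n"] by (simp only: power2_eq_square flip: of_nat_mult)
    ultimately show ?thesis by (simp add: t_def)
  qed
  have sym: "t (- n) = t n" for n by (simp add: t_def add.commute)
  have "(\<Sum>n = - int N..int N. t n) = 2 * (\<Sum>n<Suc N. mock_term 0 n) + (- 1)" for N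
  proof (induction N)
    case 0
    then show ?case by (simp add: t_def)
  next
    case (Suc N)
    have "{- int (Suc N)..int (Suc N)} = {- int N..int N} \<union> {- int (Suc N), int (Suc N)}" by auto
    then have "(\<Sum>n = - int (Suc N)..int (Suc N). t n) = (\<Sum>n = - int N..int N. t n) + (t (- int (Suc N)) + t (int (Suc N)))"
      by (simp only:) (subst sum.union_disjoint, auto)
    also have "t (- int (Suc N)) + t (int (Suc N)) = 2 * mock_term 0 (Suc N)"
      unfolding sym mock by simp
    finally show ?case unfolding Suc by (simp add: algebra_simps)
  qed
  moreover have "(\<lambda>N. 2 * (\<Sum>n<Suc N. mock_term 0 n) + (- 1)) \<longlonglongrightarrow> 2 * mock_sum 0 + (- 1)"
    by (intro fps_tendsto_add fps_tendsto_mult tendsto_const LIMSEQ_Suc[OF mock_sum_tendsto])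
  ultimately have "2 * mock_sum 0 + (- 1) = fps_dilate 2 (theta 1)"
    using LIMSEQ_unique[OF _ lim] by simp
  then show ?thesis by (simp add: mock_bilateral_def)
qed

theorem mock_bilateral_product:
  "fps_dilate 2 (odd_prod (-1)) * mock_bilateral 1 = fps_dilate 2 (odd_prod 1) * fps_dilate 2 (theta 1)"
proof (rule LIMSEQ_unique)
  have odd: "(\<lambda>N. \<Prod>i<N. 1 + fps_const \<sigma> * fps_X ^ (4 * i + 2)) \<longlonglongrightarrow> fps_dilate 2 (odd_prod \<sigma>)" for \<sigma>
  proof -
    have "(\<lambda>N. fps_dilate 2 (\<Prod>i<N. 1 + fps_const \<sigma> * fps_X ^ (2 * i + 1))) \<longlonglongrightarrow> fps_dilate 2 (odd_prod \<sigma>)"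
      by (intro fps_dilate_tendsto odd_prod_tendsto) simp
    moreover have "fps_dilate 2 (fps_const \<sigma>) = fps_const \<sigma>" by (simp add: fps_dilate_def)
    moreover have "(fps_X\<^sup>2) ^ (2 * i + 1) = (fps_X :: int fps) ^ (4 * i + 2)" for i
      unfolding power_mult[symmetric] by (rule arg_cong[where f = "power fps_X"]) simp
    ultimately show ?thesis
      by (simp only: fps_dilate_prod[OF zero_less_numeral] fps_dilate_add fps_dilate_1
          fps_dilate_mult[OF zero_less_numeral] fps_dilate_power[OF zero_less_numeral] fps_dilate_X[OF zero_less_numeral])
  qed
  show "(\<lambda>N. (\<Prod>i<N. 1 + fps_const (-1) * fps_X ^ (4 * i + 2)) * mock_bilateral 1) \<longlonglongrightarrow>
      fps_dilate 2 (odd_prod (-1)) * mock_bilateral 1"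
    by (intro fps_tendsto_mult odd tendsto_const)
  have lim: "(\<lambda>N. mock_bilateral (fps_X ^ (2 * N))) \<longlonglongrightarrow> fps_dilate 2 (theta 1)"
    unfolding mock_bilateral_0[symmetric]
  proof (rule fps_tendsto_cong_dvd[OF tendsto_const])
    fix N
    have "fps_X ^ N dvd (fps_X :: int fps) ^ (2 * N)" by (intro le_imp_power_dvd) simp
    then have "dcong (fps_X ^ N) (mock_sum (fps_X ^ (2 * N))) (mock_sum 0)"
      "dcong (fps_X ^ N) (mock_sum (- (fps_X ^ (2 * N)))) (mock_sum (- 0))"
      using mock_sum_dcong[of N "fps_X ^ (2 * N)"] mock_sum_dcong[of N "- (fps_X ^ (2 * N))"] by simp_all
    from dcong_add[OF dcong_add[OF this] dcong_refl[of _ "- 1"]]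
    show "fps_X ^ N dvd mock_bilateral (fps_X ^ (2 * N)) - mock_bilateral 0"
      by (simp add: mock_bilateral_def dcong_def)
  qed
  have "1 + fps_const (-1) * f = 1 - f" "1 + fps_const 1 * f = 1 + f" for f :: "int fps"
    by (simp_all flip: fps_const_neg)
  then have "(\<Prod>i<N. 1 + fps_const (-1) * fps_X ^ (4 * i + 2)) * mock_bilateral 1 =
      (\<Prod>i<N. 1 + fps_const 1 * fps_X ^ (4 * i + 2)) * mock_bilateral (fps_X ^ (2 * N))" for N
    by (simp only: mock_bilateral_iterate)
  then show "(\<lambda>N. (\<Prod>i<N. 1 + fps_const (-1) * fps_X ^ (4 * i + 2)) * mock_bilateral 1) \<longlonglongrightarrow>
      fps_dilate 2 (odd_prod 1) * fps_dilate 2 (theta 1)"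
    by (simp only:) (intro fps_tendsto_mult odd lim)
qed

section \<open>Return to the coefficients of v0\<close>

lemma mock_sum_1_nth: "fps_nth (mock_sum 1) n = v0 n"
proof -
  have "mock_term 1 k = v0_term k" for k
  proof -
    have *: "q_pochhammer (c * fps_X) (fps_X\<^sup>2) k = (\<Prod>i<k. 1 - c * fps_X ^ (2 * i + 1))" for c :: "int fps"
      unfolding q_pochhammer_def
      by (rule prod.reindex_bij_witness[where i = Suc and j = "\<lambda>i. i - 1"])
        (auto simp: mult.assoc simp flip: power_mult)
    show ?thesis
      using *[of 1] *[of "- 1"] by (simp add: mock_term_def v0_term_def mock_denom_def)
  qed
  then show ?thesis by (simp add: mock_sum_def v0_eq_sum)
qed

text \<open>Under q to -q the k numerator factors become those at g = -1 up to the sign (-1)^k,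
  which cancels the sign (-1)^(k^2) of the leading power.\<close>

lemma mock_sum_minus_1_nth: "fps_nth (mock_sum (- 1)) n = (- 1) ^ n * v0 n"
proof -
  have "mock_term (- 1) k = mock_term 1 k oo (- fps_X)" for k
  proof -
    have X0: "fps_nth (- fps_X :: int fps) 0 = 0" by simp
    have odd: "(- (fps_X :: int fps)) ^ (2 * i + 1) = - (fps_X ^ (2 * i + 1))" for i by simp
    have den: "mock_denom 1 k oo (- fps_X) = mock_denom (- 1) k"
      unfolding mock_denom_def fps_compose_prod_distrib[OF X0]
      by (intro prod.cong refl) (simp add: fps_compose_sub_distrib fps_X_power_compose odd del: power_Suc)
    have num: "(\<Prod>i<k. 1 + fps_X ^ (2 * i + 1)) oo (- fps_X) = (- 1) ^ k * (\<Prod>i<k. - 1 + (fps_X :: int fps) ^ (2 * i + 1))"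
    proof -
      have "(\<Prod>i<k. 1 + fps_X ^ (2 * i + 1)) oo (- fps_X) = (\<Prod>i<k. (- 1) * (- 1 + (fps_X :: int fps) ^ (2 * i + 1)))"
        unfolding fps_compose_prod_distrib[OF X0]
        by (intro prod.cong refl) (simp add: fps_compose_add_distrib fps_X_power_compose odd del: power_Suc)
      then show ?thesis by (simp only: prod.distrib prod_constant card_lessThan)
    qed
    have "(mock_term 1 k oo (- fps_X)) * mock_denom (- 1) k = (mock_term 1 k * mock_denom 1 k) oo (- fps_X)"
      unfolding fps_compose_mult_distrib[OF X0] den ..
    also have "\<dots> = (- fps_X) ^ k\<^sup>2 * ((- 1) ^ k * (\<Prod>i<k. - 1 + fps_X ^ (2 * i + 1)))"
      unfolding mock_term_denom fps_compose_mult_distrib[OF X0] num by (simp add: fps_X_power_compose)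
    also have "\<dots> = fps_X ^ k\<^sup>2 * (\<Prod>i<k. - 1 + fps_X ^ (2 * i + 1))"
      by (cases "even k") (simp_all add: power_minus_odd power_minus_even)
    also have "\<dots> = mock_term (- 1) k * mock_denom (- 1) k"
      by (simp add: mock_term_denom)
    finally show ?thesis using mock_denom_nonzero[of "- 1" k] by simp
  qed
  then show ?thesis
    by (simp add: mock_sum_def fps_compose_uminus' sum_distrib_left flip: mock_sum_1_nth)
qed

definition v0_even :: "int fps"
  where "v0_even = fps_section 2 0 (mock_bilateral 1)"

lemma v0_even_nth: "fps_nth v0_even n = 2 * v0 (2 * n) - (if n = 0 then 1 else 0)"
  by (simp add: v0_even_def mock_bilateral_def mock_sum_1_nth mock_sum_minus_1_nth)

theorem v0_even_theta: "v0_even * fps_dilate 2 (theta (- 1)) = theta 1 ^ 2"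
proof -
  have "odd_prod (-1) * v0_even = fps_section 2 0 (fps_dilate 2 (odd_prod 1 * theta 1))"
    unfolding v0_even_def by (subst fps_section_dilate_mult[symmetric]) (simp_all add: mock_bilateral_product fps_dilate_mult)
  then have v: "odd_prod (-1) * v0_even = odd_prod 1 * theta 1"
    by (simp add: fps_section_dilate)
  have E: "fps_dilate 2 (odd_prod (-1)) * fps_dilate 4 euler = fps_dilate 2 euler"
    using arg_cong[OF odd_prod_euler, of "fps_dilate 2"] by (simp add: fps_dilate_simps)
  have "odd_prod (-1) * (v0_even * fps_dilate 2 (theta (-1))) =
      (odd_prod (-1) * v0_even) * fps_dilate 2 (odd_prod (-1)) * (fps_dilate 2 (odd_prod (-1)) * fps_dilate 4 euler)"
    by (simp add: theta_product fps_dilate_simps power2_eq_square mult_ac)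
  also have "\<dots> = odd_prod 1 * theta 1 * (odd_prod (-1) * odd_prod 1) * fps_dilate 2 euler"
    unfolding E v odd_prod_mult ..
  also have "\<dots> = odd_prod (-1) * (theta 1 * (odd_prod 1 ^ 2 * fps_dilate 2 euler))"
    by (simp add: power2_eq_square mult_ac)
  also have "\<dots> = odd_prod (-1) * theta 1 ^ 2"
    by (subst theta_product[of 1, symmetric]) (simp_all add: power2_eq_square)
  finally show ?thesis using odd_prod_nth_0[of "- 1"] by (metis fps_zero_nth mult_cancel_left zero_neq_one)
qed

definition v0_fourth :: "int fps"
  where "v0_fourth = fps_section 2 0 v0_even"

lemma v0_fourth_nth: "fps_nth v0_fourth n = 2 * v0 (4 * n) - (if n = 0 then 1 else 0)"
  by (simp add: v0_fourth_def v0_even_nth)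

text \<open>The even part of \<phi>(q)^2 is \<phi>(q^2)^2, so passing to every fourth coefficient
  keeps the right-hand side and only replaces \<phi>(-q^2) by \<phi>(-q).\<close>

theorem v0_fourth_theta: "v0_fourth * theta (- 1) = theta 1 ^ 2"
proof -
  have "theta (- 1) * v0_fourth = fps_section 2 0 (fps_dilate 2 (theta (- 1)) * v0_even)"
    by (simp add: v0_fourth_def fps_section_dilate_mult)
  also have "fps_dilate 2 (theta (- 1)) * v0_even = theta 1 ^ 2"
    using v0_even_theta by (simp add: mult.commute)
  also have "theta 1 ^ 2 = fps_dilate 2 (theta 1 ^ 2) + fps_dilate 2 (4 * fps_dilate 2 psi ^ 2) * fps_X ^ 1"
    by (subst theta_square[of 1]) (simp_all add: fps_dilate_simps mult_ac)
  also have "fps_section 2 0 \<dots> = theta 1 ^ 2"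
    unfolding fps_section_add by (subst fps_section_dilate_X_power) (simp_all add: fps_section_dilate)
  finally show ?thesis by (simp add: mult.commute)
qed

lemma const_term_1_nonzero: "fps_nth f 0 = 1 \<Longrightarrow> f \<noteq> (0 :: int fps)"
  by auto

lemma theta_nth_0: "\<sigma> * \<sigma> = 1 \<Longrightarrow> fps_nth (theta \<sigma>) 0 = 1"
  by (simp add: theta_product fps_mult_nth_0 fps_nth_power_0)

subsection \<open>The progression 4 modulo 32\<close>

definition v0_32 :: "int fps"
  where "v0_32 = fps_section 2 0 (fps_section 4 1 v0_fourth)"

lemma v0_32_nth: "fps_nth v0_32 n = 2 * v0 (4 * (8 * n + 1))"
  by (simp add: v0_32_def v0_fourth_nth)

text \<open>Iterating \<phi>(q) \<phi>(-q) = \<phi>(-q^2)^2 three times replaces the denominator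
  \<phi>(-q) by \<phi>(-q^8)^8. As a series in q^8 it passes through the sections by 4 and by 2 that
  follow.\<close>

lemma v0_fourth_expand:
  "v0_fourth * fps_dilate 8 (theta (- 1)) ^ 8 = theta 1 ^ 3 * fps_dilate 2 (theta 1) ^ 2 * fps_dilate 4 (theta 1) ^ 4"
proof -
  have m: "fps_dilate 2 (theta (- 1)) ^ 2 = theta 1 * theta (- 1)"
    by (rule theta_mult_theta[symmetric])
  have m2: "fps_dilate 4 (theta (- 1)) ^ 2 = fps_dilate 2 (theta 1) * fps_dilate 2 (theta (- 1))"
    using arg_cong[OF m, of "fps_dilate 2"] by (simp add: fps_dilate_simps)
  have m4: "fps_dilate 8 (theta (- 1)) ^ 2 = fps_dilate 4 (theta 1) * fps_dilate 4 (theta (- 1))"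
    using arg_cong[OF m, of "fps_dilate 4"] by (simp add: fps_dilate_simps)
  have "fps_dilate 8 (theta (- 1)) ^ 8 = (fps_dilate 8 (theta (- 1)) ^ 2) ^ 4"
    by (simp flip: power_mult)
  also have "\<dots> = fps_dilate 4 (theta 1) ^ 4 * (fps_dilate 4 (theta (- 1)) ^ 2) ^ 2"
    unfolding m4 by (simp add: power_mult_distrib flip: power_mult)
  also have "\<dots> = fps_dilate 4 (theta 1) ^ 4 * (fps_dilate 2 (theta 1) ^ 2 * (theta 1 * theta (- 1)))"
    unfolding m2 by (simp add: power_mult_distrib m)
  finally have "v0_fourth * fps_dilate 8 (theta (- 1)) ^ 8 =
      (v0_fourth * theta (- 1)) * theta 1 * fps_dilate 2 (theta 1) ^ 2 * fps_dilate 4 (theta 1) ^ 4"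
    by (simp add: mult_ac)
  then show ?thesis unfolding v0_fourth_theta by (simp add: power3_eq_cube power2_eq_square)
qed

lemma v0_16_expand:
  "fps_section 4 1 v0_fourth * fps_dilate 2 (theta (- 1)) ^ 8 =
    6 * theta 1 ^ 8 * fps_dilate 2 psi + 32 * fps_X * theta 1 ^ 4 * fps_dilate 2 psi ^ 5"
proof -
  define x y where "x = theta 1" and "y = fps_dilate 2 psi"
  have t: "theta 1 = fps_dilate 4 x + 2 * fps_X * fps_dilate 4 y"
    using theta_dissect by (simp add: x_def y_def)
  have t2: "fps_dilate 2 (theta 1) ^ 2 = fps_dilate 4 x ^ 2 + 4 * fps_X ^ 2 * fps_dilate 4 y ^ 2"
    using arg_cong[OF theta_square[of 1], of "fps_dilate 2"] by (simp add: fps_dilate_simps x_def y_def)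
  have "fps_dilate 4 (fps_dilate 2 (theta (- 1)) ^ 8) * v0_fourth = v0_fourth * fps_dilate 8 (theta (- 1)) ^ 8"
    by (simp add: fps_dilate_simps mult.commute)
  also have "\<dots> = theta 1 ^ 3 * fps_dilate 2 (theta 1) ^ 2 * fps_dilate 4 x ^ 4"
    unfolding v0_fourth_expand x_def ..
  also have "\<dots> = (fps_dilate 4 x + 2 * fps_X * fps_dilate 4 y) ^ 3 *
      (fps_dilate 4 x ^ 2 + 4 * fps_X ^ 2 * fps_dilate 4 y ^ 2) * fps_dilate 4 x ^ 4"
    by (simp only: t2) (subst t, rule refl)
  \<comment> \<open>Among the six powers of q only the first and the fifth lie in the class 1 modulo
    4; their coefficients are the 6 and 32 of the result.\<close>
  also have "\<dots> = fps_dilate 4 (x ^ 9) * fps_X ^ 0 + fps_dilate 4 (6 * x ^ 8 * y) * fps_X ^ 1 +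
      fps_dilate 4 (16 * x ^ 7 * y ^ 2) * fps_X ^ 2 + fps_dilate 4 (32 * x ^ 6 * y ^ 3) * fps_X ^ 3 +
      fps_dilate 4 (48 * x ^ 5 * y ^ 4) * fps_X ^ 4 + fps_dilate 4 (32 * x ^ 4 * y ^ 5) * fps_X ^ 5"
    by (simp only: fps_dilate_mult[OF zero_less_numeral] fps_dilate_power[OF zero_less_numeral] fps_dilate_numeral)
      (simp add: eval_nat_numeral algebra_simps)
  finally have "fps_section 4 1 (fps_dilate 4 (fps_dilate 2 (theta (- 1)) ^ 8) * v0_fourth) =
      6 * x ^ 8 * y + 32 * x ^ 4 * y ^ 5 * fps_X"
    by (simp only: fps_section_add fps_section_dilate_X_power) simp
  then show ?thesis
    by (subst (asm) fps_section_dilate_mult) (simp_all add: x_def y_def mult_ac)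
qed

text \<open>The even part of \<phi>^8 yields \<phi>(-q)^8 + 128 q \<psi>^8 and that of q \<phi>^4
  yields 8 q \<psi>^4. The constant is 1024 = 6 * 128 + 32 * 8.\<close>

lemma v0_32_expand:
  "v0_32 * theta (- 1) ^ 8 = 6 * psi * theta (- 1) ^ 8 + 1024 * fps_X * psi ^ 9"
proof -
  define a b u m where "a = theta 1 ^ 2" and "b = fps_dilate 2 psi ^ 2" and "u = a ^ 2 + 16 * fps_X * b ^ 2"
    and "m = theta (- 1)"
  have "theta 1 ^ 2 = fps_dilate 2 a + 4 * fps_X * fps_dilate 2 b"
    by (subst theta_square) (simp_all add: a_def b_def fps_dilate_simps)
  moreover have "theta 1 ^ 4 = (theta 1 ^ 2) ^ 2" by (simp flip: power_mult)
  ultimately have t4: "theta 1 ^ 4 = fps_dilate 2 u + 8 * fps_X * fps_dilate 2 (a * b)"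
    by (simp add: u_def fps_dilate_simps) (simp add: eval_nat_numeral algebra_simps)
  have "theta 1 ^ 8 = (theta 1 ^ 4) ^ 2" by (simp flip: power_mult)
  then have "theta 1 ^ 8 = fps_dilate 2 (u ^ 2 + 64 * fps_X * (a * b) ^ 2) * fps_X ^ 0 +
      fps_dilate 2 (16 * u * (a * b)) * fps_X ^ 1"
    unfolding t4 by (simp add: fps_dilate_simps) (simp add: eval_nat_numeral algebra_simps)
  then have s8: "fps_section 2 0 (theta 1 ^ 8) = u ^ 2 + 64 * fps_X * (a * b) ^ 2"
    by (simp only: fps_section_add fps_section_dilate_X_power) simp
  have "fps_X * theta 1 ^ 4 = fps_dilate 2 u * fps_X ^ 1 + fps_dilate 2 (8 * a * b) * fps_X ^ 2"
    unfolding t4 by (simp add: fps_dilate_simps) (simp add: eval_nat_numeral algebra_simps)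
  then have s4: "fps_section 2 0 (fps_X * theta 1 ^ 4) = 8 * a * b * fps_X"
    by (simp only: fps_section_add fps_section_dilate_X_power) simp
  have "m ^ 8 * v0_32 = fps_section 2 0 (fps_dilate 2 (m ^ 8) * fps_section 4 1 v0_fourth)"
    unfolding v0_32_def by (rule fps_section_dilate_mult[symmetric]) simp
  also have "fps_dilate 2 (m ^ 8) * fps_section 4 1 v0_fourth =
      fps_dilate 2 (6 * psi) * theta 1 ^ 8 + fps_dilate 2 (32 * psi ^ 5) * (fps_X * theta 1 ^ 4)"
    using v0_16_expand by (simp add: m_def fps_dilate_simps mult_ac)
  also have "fps_section 2 0 \<dots> = 6 * psi * (u ^ 2 + 64 * fps_X * (a * b) ^ 2) + 32 * psi ^ 5 * (8 * a * b * fps_X)"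
    by (simp only: fps_section_add fps_section_dilate_mult[OF zero_less_numeral] s8 s4)
  also have ab: "a * b = psi ^ 4"
  proof -
    have "a * b = (theta 1 * fps_dilate 2 psi) ^ 2" by (simp add: a_def b_def power_mult_distrib)
    also have "\<dots> = psi ^ 4" unfolding psi_square[symmetric] by (simp flip: power_mult)
    finally show ?thesis .
  qed
  also have "u ^ 2 = m ^ 8 + 64 * fps_X * (a * b) ^ 2"
  proof -
    have "a ^ 2 = m ^ 4 + 16 * fps_X * b ^ 2"
      using theta_fourth_power by (simp add: a_def b_def m_def flip: power_mult)
    then have "(a ^ 2 - 16 * fps_X * b ^ 2) ^ 2 = m ^ 8" by (simp flip: power_mult)
    \<comment> \<open>An instance of (s + t)^2 = (s - t)^2 + 4 s t; the quartic identity identifies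
      s - t with \<phi>(-q)^4.\<close>
    moreover have "u ^ 2 = (a ^ 2 - 16 * fps_X * b ^ 2) ^ 2 + 64 * fps_X * (a * b) ^ 2"
      unfolding u_def by (simp add: eval_nat_numeral algebra_simps)
    ultimately show ?thesis by simp
  qed
  also have "6 * psi * (m ^ 8 + 64 * fps_X * (a * b) ^ 2 + 64 * fps_X * (psi ^ 4) ^ 2) + 32 * psi ^ 5 * (8 * a * b * fps_X) =
      6 * psi * m ^ 8 + 1024 * fps_X * psi ^ 9"
    unfolding mult.assoc[of 8 a b] ab by (simp add: eval_nat_numeral algebra_simps)
  finally show ?thesis by (simp add: m_def mult.commute)
qed

subsection \<open>Reduction modulo 27\<close>

definition mock_quot :: "int fps"
  where "mock_quot = psi ^ 9 * fps_right_inverse (theta (- 1) ^ 8) 1"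

lemma mock_quot_mult: "mock_quot * theta (- 1) ^ 8 = psi ^ 9"
proof -
  have "theta (- 1) ^ 8 * fps_right_inverse (theta (- 1) ^ 8) 1 = 1"
    by (rule fps_right_inverse) (simp add: fps_nth_power_0 theta_nth_0)
  then show ?thesis by (simp add: mock_quot_def mult_ac)
qed

lemma v0_32_eq: "v0_32 = 6 * psi + 1024 * fps_X * mock_quot"
proof -
  have "theta (- 1) ^ 8 * v0_32 = theta (- 1) ^ 8 * (6 * psi + 1024 * fps_X * mock_quot)"
    using v0_32_expand by (simp add: algebra_simps flip: mock_quot_mult)
  moreover have "theta (- 1) ^ 8 \<noteq> 0" using const_term_1_nonzero[OF theta_nth_0[of "- 1"]] by simp
  ultimately show ?thesis by (simp only: mult_cancel_left simp_thms)
qed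

lemma euler_nonzero: "euler \<noteq> 0" "fps_dilate 2 euler \<noteq> 0"
  by (rule const_term_1_nonzero, simp)+

lemma euler_cube_theta: "euler ^ 3 = psi * theta (- 1) ^ 2"
proof -
  have "(psi * theta (- 1) ^ 2) * (euler * fps_dilate 2 euler ^ 2) =
      (psi * euler) * (theta (- 1) * fps_dilate 2 euler) ^ 2"
    by (simp add: power_mult_distrib mult_ac)
  also have "\<dots> = euler ^ 3 * (euler * fps_dilate 2 euler ^ 2)"
    unfolding psi_euler theta_minus_euler by (simp add: eval_nat_numeral algebra_simps)
  finally show ?thesis using euler_nonzero by simp
qed

lemma euler_dilate_cube_theta: "fps_dilate 2 euler ^ 3 = psi ^ 2 * theta (- 1)"
proof -
  have "(psi ^ 2 * theta (- 1)) * (euler ^ 2 * fps_dilate 2 euler) =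
      (psi * euler) ^ 2 * (theta (- 1) * fps_dilate 2 euler)"
    by (simp add: power_mult_distrib mult_ac)
  also have "\<dots> = fps_dilate 2 euler ^ 3 * (euler ^ 2 * fps_dilate 2 euler)"
    unfolding psi_euler theta_minus_euler by (simp add: eval_nat_numeral algebra_simps)
  finally show ?thesis using euler_nonzero by simp
qed

text \<open>The quotient is \<phi>(-q) times the ninth power of \<psi> / \<phi>(-q), and that ratio
  is the cube of E(q^2) / E(q). Ninth powers of cubes are what congruences modulo 3 control modulo
  27.\<close>

lemma mock_quot_euler: "mock_quot * euler ^ 27 = theta (- 1) * fps_dilate 2 euler ^ 27"
proof -
  have "mock_quot * (euler ^ 3) ^ 9 = (mock_quot * theta (- 1) ^ 8) * psi ^ 9 * theta (- 1) ^ 10"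
    unfolding euler_cube_theta by (simp add: eval_nat_numeral algebra_simps)
  also have "\<dots> = theta (- 1) * (fps_dilate 2 euler ^ 3) ^ 9"
    unfolding mock_quot_mult euler_dilate_cube_theta by (simp add: eval_nat_numeral algebra_simps)
  finally show ?thesis by (simp flip: power_mult)
qed

text \<open>The cofactor of x - y in x^3 - y^3 is (x - y)(x + 2y) + 3y^2, which is divisible by
  3.\<close>

lemma dcong_power3:
  assumes "dcong d x y" "3 dvd d"
  shows "dcong (3 * d) (x ^ 3) (y ^ 3)"
proof -
  have "dcong 3 x y" using assms by (rule dcong_weaken)
  then have "3 dvd (x - y) * (x + 2 * y) + 3 * y ^ 2" by (simp add: dcong_def)
  moreover have "(x - y) * (x + 2 * y) + 3 * y ^ 2 = x ^ 2 + x * y + y ^ 2" by (simp add: eval_nat_numeral algebra_simps)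
  ultimately have "d * 3 dvd (x - y) * (x ^ 2 + x * y + y ^ 2)"
    using assms(1) unfolding dcong_def by (intro mult_dvd_mono) simp_all
  moreover have "x ^ 3 - y ^ 3 = (x - y) * (x ^ 2 + x * y + y ^ 2)" by (simp add: eval_nat_numeral algebra_simps)
  ultimately show ?thesis by (simp add: dcong_def mult.commute)
qed

lemma dcong_diff_multiple: "dcong d (x - d * y) x"
  by (simp add: dcong_def)

lemma three_dvd_nine: "(3 :: 'a::comm_ring_1) dvd 9"
  by (rule dvdI[of _ _ 3]) simp

lemma dcong_power9: "dcong 3 x y \<Longrightarrow> dcong 27 (x ^ 9) (y ^ 9)"
  using dcong_power3[OF dcong_power3[of 3 x y]] three_dvd_nine by (simp flip: power_mult)

lemma dcong_numeral_section: "dcong (numeral m) f g \<Longrightarrow> dcong (numeral m) (fps_section k r f) (fps_section k r g)"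
  using numeral_dvd_fps_section[of m "f - g"] by (simp add: dcong_def fps_section_diff)

lemma dcong_numeral_dilate: "k > 0 \<Longrightarrow> dcong (numeral m) f g \<Longrightarrow> dcong (numeral m) (fps_dilate k f) (fps_dilate k g)"
  using numeral_dvd_fps_dilate[of k m "f - g"] by (simp add: dcong_def fps_dilate_diff)

text \<open>A square is 0 modulo 3 only for n = 3k, where it equals 9k^2 with the parity of k; the
  other classes have exponent 1 modulo 3.\<close>

lemma theta_section: "fps_section 3 0 (theta (- 1)) = fps_dilate 3 (theta (- 1))"
proof -
  define sq where "sq n = tri n + tri (- n)" for n
  define c where "c n = (-1 :: int) ^ sq n" for n
  define f where "f r k = (sq (3 * k + r) - 1) div 3" for r k
  have sq: "int (sq n) = n * n" for n unfolding sq_def by (rule tri_add_tri_uminus)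
  have s0: "sq (3 * k) = 9 * sq k" for k
    using sq[of "3 * k"] sq[of k] by simp
  have c0: "c (3 * k) = c k" for k
    unfolding c_def sq_def minus_one_power_tri by simp
  have s1: "sq (3 * k + 1) = 3 * f 1 k + 1" for k
  proof -
    have "int (sq (3 * k + 1)) = 3 * (3 * k * k + 2 * k) + 1" by (simp add: sq algebra_simps)
    then show ?thesis unfolding f_def by presburger
  qed
  have s2: "sq (3 * k + 2) = 3 * f 2 k + 1" for k
  proof -
    have "int (sq (3 * k + 2)) = 3 * (3 * k * k + 4 * k + 1) + 1" by (simp add: sq algebra_simps)
    then show ?thesis unfolding f_def by presburger
  qed
  have th: "theta (- 1) = qseries c sq" 
    unfolding theta_def by (rule arg_cong2[where f = qseries]) (auto simp: c_def sq_def)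
  have "theta (- 1) = qseries (\<lambda>k. c (3 * k)) (\<lambda>k. sq (3 * k)) + qseries (\<lambda>k. c (3 * k + 1)) (\<lambda>k. sq (3 * k + 1)) +
      qseries (\<lambda>k. c (3 * k + 2)) (\<lambda>k. sq (3 * k + 2))"
    using qseries_residues[OF zero_less_numeral, of sq c "num.Bit1 num.One"] square_fibre
    unfolding th sq_def[symmetric] by (simp add: numeral_3_eq_3 add.assoc)
  also have "\<dots> = fps_dilate 3 (fps_dilate 3 (theta (- 1))) * fps_X ^ 0 +
      fps_dilate 3 (qseries (\<lambda>k. c (3 * k + 1)) (f 1)) * fps_X ^ 1 +
      fps_dilate 3 (qseries (\<lambda>k. c (3 * k + 2)) (f 2)) * fps_X ^ 1"
    unfolding s0 s1 s2 c0 qseries_shift qseries_dilate[OF zero_less_numeral] th[symmetric]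
    by (simp add: mult.commute)
  finally have eq: "theta (- 1) = fps_dilate 3 (fps_dilate 3 (theta (- 1))) * fps_X ^ 0 +
      fps_dilate 3 (qseries (\<lambda>k. c (3 * k + 1)) (f 1)) * fps_X ^ 1 +
      fps_dilate 3 (qseries (\<lambda>k. c (3 * k + 2)) (f 2)) * fps_X ^ 1" .
  show ?thesis
    by (subst eq, simp only: fps_section_add fps_section_dilate_mult[OF zero_less_numeral]
        fps_section_X_power[OF zero_less_numeral]) simp
qed

lemma euler_cube_dissect: "euler ^ 3 = fps_dilate 3 cubic_part - 3 * fps_X * fps_dilate 9 (euler ^ 3)"
  using jacobi_cube_dissect by (simp only: euler_cube)

lemma cubic_part_nth_0: "fps_nth cubic_part 0 = 1"
  using arg_cong[OF euler_cube_dissect, of "\<lambda>f. fps_nth f 0"]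
  by (simp add: fps_nth_power_0 fps_mult_nth_0 mult.assoc)

lemma dcong_3_cubic_part: "dcong 3 cubic_part euler"
proof -
  have "3 dvd (-1) ^ k * (6 * n + 1) - (-1 :: int) ^ k" for k :: nat and n :: int
    by (simp add: algebra_simps)
  then show ?thesis
    unfolding dcong_def cubic_part_def pentagonal_number_theorem
    by (intro qseries_cong_dvd) simp
qed

lemma dcong_3_euler_cube: "dcong 3 (euler ^ 3) (fps_dilate 3 cubic_part)"
  unfolding dcong_def by (subst euler_cube_dissect) simp

text \<open>Modulo 27 both 27th powers are series in q^3 and leave the section, so only \<phi>(-q)
  has to be dissected.\<close>

lemma mock_quot_section:
  "dcong 27 (fps_section 3 0 mock_quot * euler ^ 9) (fps_dilate 3 (theta (- 1)) * fps_dilate 2 euler ^ 9)"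
proof -
  have P: "dcong 27 (euler ^ 27) (fps_dilate 3 (cubic_part ^ 9))"
    using dcong_power9[OF dcong_3_euler_cube] by (simp add: fps_dilate_simps flip: power_mult)
  have P2: "dcong 27 (fps_dilate 2 euler ^ 27) (fps_dilate 3 (fps_dilate 2 cubic_part ^ 9))"
    using dcong_numeral_dilate[OF _ P, of 2] by (simp add: fps_dilate_simps)
  have "dcong 27 (fps_dilate 3 (cubic_part ^ 9) * mock_quot) (euler ^ 27 * mock_quot)"
    by (intro dcong_mult dcong_refl dcong_sym[OF P])
  also have "euler ^ 27 * mock_quot = fps_dilate 2 euler ^ 27 * theta (- 1)"
    using mock_quot_euler by (simp add: mult.commute)
  also have "dcong 27 \<dots> (fps_dilate 3 (fps_dilate 2 cubic_part ^ 9) * theta (- 1))"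
    by (intro dcong_mult dcong_refl P2)
  finally have "dcong 27 (cubic_part ^ 9 * fps_section 3 0 mock_quot) (fps_dilate 2 cubic_part ^ 9 * fps_dilate 3 (theta (- 1)))"
    by (drule_tac dcong_numeral_section[where k = 3 and r = 0])
      (simp only: fps_section_dilate_mult[OF zero_less_numeral] theta_section)
  moreover have "dcong 27 (cubic_part ^ 9) (euler ^ 9)"
    by (rule dcong_power9) (rule dcong_3_cubic_part)
  moreover from this have "dcong 27 (fps_dilate 2 cubic_part ^ 9) (fps_dilate 2 euler ^ 9)"
    using dcong_numeral_dilate[of 2] by (simp flip: fps_dilate_power)
  ultimately have "dcong 27 (euler ^ 9 * fps_section 3 0 mock_quot) (fps_dilate 2 euler ^ 9 * fps_dilate 3 (theta (- 1)))"
    by (meson dcong_mult dcong_refl dcong_sym dcong_trans)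
  then show ?thesis by (simp add: mult.commute)
qed

lemma mock_quot_section2:
  "dcong 27 (fps_section 3 0 (fps_section 3 0 mock_quot) * cubic_part ^ 3) (theta (- 1) * fps_dilate 2 cubic_part ^ 3)"
proof -
  define h where "h = fps_section 3 0 mock_quot"
  define P P2 J J2 where "P = cubic_part" and "P2 = fps_dilate 2 cubic_part"
    and "J = fps_dilate 3 (euler ^ 3)" and "J2 = fps_dilate 6 (euler ^ 3)"
  define p w p2 w2 t where "p = fps_dilate 3 P" and "w = fps_X * fps_dilate 3 J"
    and "p2 = fps_dilate 3 P2" and "w2 = fps_X ^ 2 * fps_dilate 3 J2" and "t = fps_dilate 3 (theta (- 1))"
  have e: "euler ^ 3 = p - 3 * w"
    using euler_cube_dissect by (simp add: p_def w_def P_def J_def mult.assoc)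
  have e2: "fps_dilate 2 euler ^ 3 = p2 - 3 * w2"
    using arg_cong[OF euler_cube_dissect, of "fps_dilate 2"]
    by (simp add: p2_def w2_def P2_def J2_def fps_dilate_simps mult.assoc)
  \<comment> \<open>Modulo 27 the cube of p - 3w is p^3 - 9 p^2 w. The extra factor completes it to
    p^6, a series in q^3 that passes through the section.\<close>
  have "dcong 27 (h * p ^ 6) (h * (euler ^ 3) ^ 3 * (p ^ 3 + 9 * p ^ 2 * w))"
  proof -
    have "h * p ^ 6 - h * (p - 3 * w) ^ 3 * (p ^ 3 + 9 * p ^ 2 * w) =
        27 * (h * (3 * p ^ 4 * w ^ 2 - p * w ^ 2 * (p ^ 3 + 9 * p ^ 2 * w) + w ^ 3 * (p ^ 3 + 9 * p ^ 2 * w)))"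
      by (simp add: eval_nat_numeral algebra_simps)
    then show ?thesis unfolding dcong_def e by simp
  qed
  also have "h * (euler ^ 3) ^ 3 * (p ^ 3 + 9 * p ^ 2 * w) = (h * euler ^ 9) * (p ^ 3 + 9 * p ^ 2 * w)"
    by (simp flip: power_mult)
  also have "dcong 27 \<dots> ((t * fps_dilate 2 euler ^ 9) * (p ^ 3 + 9 * p ^ 2 * w))"
    unfolding h_def t_def by (intro dcong_mult dcong_refl mock_quot_section)
  also have "(t * fps_dilate 2 euler ^ 9) * (p ^ 3 + 9 * p ^ 2 * w) =
      t * (fps_dilate 2 euler ^ 3) ^ 3 * (p ^ 3 + 9 * p ^ 2 * w)"
    by (simp flip: power_mult)
  \<comment> \<open>Only terms linear in w or w2 survive, with exponents 1 and 2 modulo 3, and the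
    section will remove them. The product of w and w2 would reach the section, but its coefficient
    is a multiple of 81.\<close>
  also have "dcong 27 \<dots> (t * p2 ^ 3 * p ^ 3 + 9 * t * p2 ^ 3 * p ^ 2 * w - 9 * t * p2 ^ 2 * p ^ 3 * w2)"
  proof -
    have "t * (p2 - 3 * w2) ^ 3 * (p ^ 3 + 9 * p ^ 2 * w) -
        (t * p2 ^ 3 * p ^ 3 + 9 * t * p2 ^ 3 * p ^ 2 * w - 9 * t * p2 ^ 2 * p ^ 3 * w2) =
        27 * (t * ((p2 * w2 ^ 2 - w2 ^ 3) * (p ^ 3 + 9 * p ^ 2 * w) - 3 * p2 ^ 2 * w2 * p ^ 2 * w))"
      by (simp add: eval_nat_numeral algebra_simps)
    then show ?thesis unfolding dcong_def e2 by simp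
  qed
  also have "t * p2 ^ 3 * p ^ 3 + 9 * t * p2 ^ 3 * p ^ 2 * w - 9 * t * p2 ^ 2 * p ^ 3 * w2 =
      fps_dilate 3 (theta (- 1) * P2 ^ 3 * P ^ 3) * fps_X ^ 0 +
      fps_dilate 3 (9 * theta (- 1) * P2 ^ 3 * P ^ 2 * J) * fps_X ^ 1 -
      fps_dilate 3 (9 * theta (- 1) * P2 ^ 2 * P ^ 3 * J2) * fps_X ^ 2"
    unfolding t_def p2_def p_def w_def w2_def
      fps_dilate_mult[OF zero_less_numeral] fps_dilate_power[OF zero_less_numeral] fps_dilate_numeral
    by (simp add: eval_nat_numeral algebra_simps)
  also have "h * p ^ 6 = fps_dilate 3 (P ^ 6) * h"
    by (simp add: p_def fps_dilate_simps mult.commute)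
  finally have "dcong 27 (P ^ 6 * fps_section 3 0 h) (theta (- 1) * P2 ^ 3 * P ^ 3)"
    by (drule_tac dcong_numeral_section[where k = 3 and r = 0], simp only: fps_section_add fps_section_diff
        fps_section_dilate_mult[OF zero_less_numeral] fps_section_X_power[OF zero_less_numeral]) simp
  then have "dcong 27 (P ^ 3 * (fps_section 3 0 h * P ^ 3)) (P ^ 3 * (theta (- 1) * P2 ^ 3))"
    by (simp add: mult_ac flip: power_add)
  then show ?thesis unfolding h_def P2_def P_def
    by (rule dcong_cancel[rotated]) (simp add: fps_nth_power_0 cubic_part_nth_0)
qed

section \<open>The operator q d/dq and the comparison of P with E\<close>

definition qderiv :: "int fps \<Rightarrow> int fps"
  where "qderiv f = fps_X * fps_deriv f"

lemma qderiv_nth: "fps_nth (qderiv f) n = int n * fps_nth f n"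
  by (cases n) (simp_all add: qderiv_def)

lemma qderiv_mult: "qderiv (f * g) = qderiv f * g + f * qderiv g"
  by (simp add: qderiv_def algebra_simps)

lemma qderiv_dilate: "k > 0 \<Longrightarrow> qderiv (fps_dilate k f) = of_nat k * fps_dilate k (qderiv f)"
  by (rule fps_ext) (auto simp: qderiv_nth fps_dilate_nth fps_mult_of_nat_nth elim!: dvdE)

lemma qderiv_qseries: "qderiv (qseries c e) = qseries (\<lambda>k. int (e k) * c k) e"
  by (simp add: fps_eq_iff qderiv_nth qseries_nth sum_distrib_left)

text \<open>With e the pentagonal exponent, 6n+1 and 1+3e differ by 3(2n-e), and 2(2n-e) = 3(n-n^2).
  Weighting coefficients by the exponent is what \<open>qderiv\<close> does.\<close>

lemma dcong_9_cubic_part: "dcong 9 cubic_part (euler + 3 * qderiv euler)"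
proof -
  define c where "c n = (-1 :: int) ^ (tri n + tri (- n))" for n
  define e where "e n = 2 * tri n + tri (- n)" for n
  have E: "euler = qseries c e"
    unfolding c_def e_def by (rule pentagonal_number_theorem)
  have "euler + 3 * qderiv euler = qseries (\<lambda>n. c n + 3 * (int (e n) * c n)) e"
    unfolding E qderiv_qseries qseries_add qseries_cmult by (simp add: numeral_fps_const)
  moreover have "9 dvd c n * (6 * n + 1) - (c n + 3 * (int (e n) * c n))" for n
  proof -
    have "2 * int (e n) = 3 * n * n + n"
      using tri_double[of n] tri_double[of "- n"] by (simp add: e_def algebra_simps)
    then have "2 * (2 * n - int (e n)) = 3 * (n - n * n)" by (simp add: algebra_simps)
    then have "3 dvd 2 * n - int (e n)" by presburger
    then obtain t where "2 * n - int (e n) = 3 * t" by blast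
    moreover have "c n * (6 * n + 1) - (c n + 3 * (int (e n) * c n)) = c n * 3 * (2 * n - int (e n))"
      by (simp add: algebra_simps)
    ultimately show ?thesis by simp
  qed
  ultimately show ?thesis
    unfolding dcong_def cubic_part_def by (simp only: flip: c_def e_def) (rule qseries_cong_dvd)
qed

text \<open>The leading part \<phi>(-q) E(q^2)^3 / E(q)^3 is \<psi>. The corrections from P and
  P(q^2) combine to the logarithmic derivative of \<psi>, read off from \<psi> E = E(q^2)^2;
  everything is done with denominators cleared.\<close>

theorem mock_quot_dcong:
  "dcong 27 (fps_section 3 0 (fps_section 3 0 mock_quot)) (psi + 9 * qderiv psi)"
proof -
  define K where "K = fps_section 3 0 (fps_section 3 0 mock_quot)"
  define E E2 D F m where "E = euler" and "E2 = fps_dilate 2 euler" and "D = qderiv euler"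
    and "F = fps_dilate 2 (qderiv euler)" and "m = theta (- 1)"
  have mE: "m * E2 = E ^ 2" unfolding m_def E_def E2_def by (rule theta_minus_euler)
  have psiE: "psi * E = E2 ^ 2" unfolding E_def E2_def by (rule psi_euler)
  have P: "dcong 27 (cubic_part ^ 3) (E ^ 3 + 9 * E ^ 2 * D)"
  proof -
    have "dcong 27 (cubic_part ^ 3) ((E + 3 * D) ^ 3)"
      using dcong_power3[OF dcong_9_cubic_part three_dvd_nine] by (simp add: E_def D_def)
    also have "(E + 3 * D) ^ 3 = (E ^ 3 + 9 * E ^ 2 * D) + 27 * (E * D ^ 2 + D ^ 3)" by (simp add: eval_nat_numeral algebra_simps)
    also have "dcong 27 \<dots> (E ^ 3 + 9 * E ^ 2 * D)" by (simp add: dcong_def)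
    finally show ?thesis .
  qed
  have P2: "dcong 27 (fps_dilate 2 cubic_part ^ 3) (E2 ^ 3 + 9 * E2 ^ 2 * F)"
    using dcong_numeral_dilate[OF _ P, of 2] by (simp add: fps_dilate_simps E_def E2_def D_def F_def)
  have "dcong 27 (K * (E ^ 3 + 9 * E ^ 2 * D)) (m * (E2 ^ 3 + 9 * E2 ^ 2 * F))"
    using mock_quot_section2 P P2 unfolding K_def m_def
    by (meson dcong_mult dcong_refl dcong_sym dcong_trans)
  \<comment> \<open>The factor E^3 - 9 E^2 D turns the coefficient of K into E^6 modulo 27, and E2
    turns m into E^2.\<close>
  then have "dcong 27 (K * (E ^ 3 + 9 * E ^ 2 * D) * (E2 * (E ^ 3 - 9 * E ^ 2 * D)))
      (m * (E2 ^ 3 + 9 * E2 ^ 2 * F) * (E2 * (E ^ 3 - 9 * E ^ 2 * D)))"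
    by (rule dcong_mult[OF _ dcong_refl])
  also have "m * (E2 ^ 3 + 9 * E2 ^ 2 * F) * (E2 * (E ^ 3 - 9 * E ^ 2 * D)) =
      (E ^ 4 * E2) * (E2 * (E2 * E + 9 * E * F - 9 * E2 * D)) - 27 * (3 * E ^ 4 * E2 ^ 2 * F * D)"
  proof -
    have "m * (E2 ^ 3 + 9 * E2 ^ 2 * F) * (E2 * (E ^ 3 - 9 * E ^ 2 * D)) =
        (m * E2) * ((E2 ^ 3 + 9 * E2 ^ 2 * F) * (E ^ 3 - 9 * E ^ 2 * D))"
      by (simp only: mult_ac)
    then show ?thesis unfolding mE by (simp add: eval_nat_numeral algebra_simps)
  qed
  also have "dcong 27 \<dots> ((E ^ 4 * E2) * (E2 * (E2 * E + 9 * E * F - 9 * E2 * D)))"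
    by (rule dcong_diff_multiple)
  also have "dcong 27 ((E ^ 4 * E2) * (E2 * (E2 * E + 9 * E * F - 9 * E2 * D)))
      ((E ^ 4 * E2) * (E ^ 2 * (psi + 9 * qderiv psi)))"
  proof -
    \<comment> \<open>The square and the dilation each contribute a factor 2. The resulting 4 may be
      replaced by 1 because it is multiplied by 9.\<close>
    have "qderiv (psi * E) = qderiv (E2 * E2)" unfolding psiE power2_eq_square ..
    moreover have "qderiv E2 = 2 * F" unfolding E2_def F_def by (simp add: qderiv_dilate)
    ultimately have "qderiv psi * E + psi * D = 4 * E2 * F"
      by (simp add: qderiv_mult E_def[symmetric] D_def[folded E_def, symmetric])
    moreover have "E ^ 2 * (psi + 9 * qderiv psi) =
        E * (psi * E) + 9 * (E * (qderiv psi * E + psi * D)) - 9 * ((psi * E) * D)"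
      by (simp add: power2_eq_square algebra_simps)
    ultimately have "E ^ 2 * (psi + 9 * qderiv psi) = E2 * (E2 * E + 9 * E * F - 9 * E2 * D) + 27 * (E * E2 * F)"
      unfolding psiE by (simp add: power2_eq_square algebra_simps)
    then have "dcong 27 (E ^ 2 * (psi + 9 * qderiv psi)) (E2 * (E2 * E + 9 * E * F - 9 * E2 * D))"
      unfolding dcong_def by (simp only: add_diff_cancel_left') simp
    then show ?thesis by (rule dcong_mult[OF dcong_refl dcong_sym])
  qed
  also have "K * (E ^ 3 + 9 * E ^ 2 * D) * (E2 * (E ^ 3 - 9 * E ^ 2 * D)) =
      (E ^ 4 * E2) * (E ^ 2 * K) - 27 * (3 * K * E2 * E ^ 4 * D ^ 2)"
    by (simp add: eval_nat_numeral algebra_simps)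
  finally have "dcong 27 ((E ^ 4 * E2) * (E ^ 2 * K) - 27 * (3 * K * E2 * E ^ 4 * D ^ 2))
      ((E ^ 4 * E2) * (E ^ 2 * (psi + 9 * qderiv psi)))" .
  moreover have "dcong 27 ((E ^ 4 * E2) * (E ^ 2 * K)) ((E ^ 4 * E2) * (E ^ 2 * K) - 27 * (3 * K * E2 * E ^ 4 * D ^ 2))"
    by (rule dcong_sym[OF dcong_diff_multiple])
  ultimately have "dcong 27 ((E ^ 6 * E2) * K) ((E ^ 6 * E2) * (psi + 9 * qderiv psi))"
    using dcong_trans by (fastforce simp: mult_ac simp flip: power_add)
  moreover have "fps_nth (E ^ 6 * E2) 0 = 1"
    by (simp add: E_def E2_def fps_mult_nth_0 fps_nth_power_0)
  ultimately show ?thesis unfolding K_def[symmetric] by (metis dcong_cancel)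
qed

subsection \<open>Non-squares\<close>

lemma psi_nth_eq_0:
  assumes "\<nexists>s. 8 * n + 1 = s ^ 2"
  shows "fps_nth psi n = 0"
proof -
  have "3 * tri k + tri (- k) \<noteq> n" for k
  proof
    assume "3 * tri k + tri (- k) = n"
    then have "int (8 * n + 1) = (4 * k + 1) ^ 2"
      using tri_double[of k] tri_double[of "- k"] by (simp add: power2_eq_square algebra_simps)
    then have "int (8 * n + 1) = int (nat \<bar>4 * k + 1\<bar> ^ 2)" by simp
    then show False using assms by (metis of_nat_eq_iff)
  qed
  then show ?thesis by (simp add: psi_def qseries_nth)
qed

lemma nonsquare_mult_square:
  fixes N d :: nat
  assumes "\<nexists>s. N = s ^ 2" "d > 0"
  shows "\<nexists>s. d ^ 2 * N = s ^ 2"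
proof
  assume "\<exists>s. d ^ 2 * N = s ^ 2"
  then obtain s where s: "d ^ 2 * N = s ^ 2" by blast
  then have "d ^ 2 dvd s ^ 2" by (metis dvd_triv_left)
  then have "d dvd s" by simp
  then obtain t where "s = d * t" by blast
  then have "N = t ^ 2" using s assms(2) by (simp add: power_mult_distrib)
  then show False using assms(1) by blast
qed

lemma v0_nonsquare:
  assumes "N mod 8 = 1" "\<nexists>s. N = s ^ 2"
  shows "[v0 (81 * (4 * N)) = 0] (mod 27)"
proof -
  define m where "m = N div 8"
  have N: "N = 8 * m + 1" using assms(1) unfolding m_def by presburger
  \<comment> \<open>Two coefficients of \<psi> must vanish: index 9m+1 comes from the congruence for
    the quotient, where 8(9m+1)+1 = 9N, and index 81m+10 from the summand 6 \<psi>, where the value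
    is 81N.\<close>
  have "\<nexists>s. 8 * (9 * m + 1) + 1 = s ^ 2"
    using nonsquare_mult_square[OF assms(2), of 3] N by (simp add: algebra_simps)
  then have z9: "fps_nth psi (9 * m + 1) = 0" by (rule psi_nth_eq_0)
  have "\<nexists>s. 8 * (81 * m + 10) + 1 = s ^ 2"
    using nonsquare_mult_square[OF assms(2), of 9] N by (simp add: algebra_simps)
  then have z81: "fps_nth psi (81 * m + 10) = 0" by (rule psi_nth_eq_0)
  \<comment> \<open>Two nested sections by 3 read the quotient at 9(9m+1) = 81m+9; the factor q in
    \<open>v0_32_eq\<close> moves this to 81m+10.\<close>
  have "27 dvd fps_nth (fps_section 3 0 (fps_section 3 0 mock_quot) - (psi + 9 * qderiv psi)) (9 * m + 1)"
    using mock_quot_dcong unfolding dcong_def numeral_dvd_fps_iff by blast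
  then have q: "27 dvd fps_nth mock_quot (81 * m + 9)"
    using z9 by (simp add: qderiv_nth numeral_fps_const mult_ac add_ac)
  have "fps_nth v0_32 (81 * m + 10) = 6 * fps_nth psi (81 * m + 10) + 1024 * fps_nth mock_quot (81 * m + 9)"
    unfolding v0_32_eq by (simp add: numeral_fps_const mult.assoc add.commute)
  then have "27 dvd fps_nth v0_32 (81 * m + 10)" using q z81 by simp
  moreover have "fps_nth v0_32 (81 * m + 10) = 2 * v0 (81 * (4 * N))"
    unfolding v0_32_nth N by (simp add: algebra_simps)
  ultimately have "27 dvd 2 * v0 (81 * (4 * N))" by simp
  then have "27 dvd v0 (81 * (4 * N))" by presburger
  then show ?thesis by (simp add: cong_0_iff)
qed

text \<open>The even power of \<open>p\<close> is absorbed into N as an odd square, which is 1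
  modulo 8 and keeps non-squares non-square.\<close>

lemma v0_nonsquare_odd_power:
  assumes "odd p" "N mod 8 = 1" "\<nexists>s. N = s ^ 2"
  shows "[v0 (p ^ (2 * \<alpha>) * 9\<^sup>2 * (4 * N)) = 0] (mod 27)"
proof -
  define d where "d = p ^ \<alpha>"
  have "odd d" using assms(1) by (simp add: d_def)
  then obtain k where k: "d = 2 * k + 1" by (elim oddE)
  have "even (k * (k + 1))" by simp
  then obtain l where "k * (k + 1) = 2 * l" by blast
  then have "d ^ 2 = 8 * l + 1" by (simp add: k power2_eq_square algebra_simps)
  then have "d ^ 2 * N = 8 * (l * N) + N" by (simp add: algebra_simps)
  then have "d ^ 2 * N mod 8 = 1" using assms(2) by (simp only: mod_mult_self4)
  moreover have "\<nexists>s. d ^ 2 * N = s ^ 2"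
    using assms(3) \<open>odd d\<close> by (intro nonsquare_mult_square) (auto intro: Nat.gr0I)
  ultimately have "[v0 (81 * (4 * (d ^ 2 * N))) = 0] (mod 27)" by (rule v0_nonsquare)
  moreover have "p ^ (2 * \<alpha>) * 9\<^sup>2 * (4 * N) = 81 * (4 * (d ^ 2 * N))"
    by (simp add: d_def power_even_eq)
  ultimately show ?thesis by (simp only:)
qed

lemma triangular_iff_square: "triangular n \<longleftrightarrow> (\<exists>s. 8 * n + 1 = s ^ 2)"
proof
  assume "triangular n"
  then obtain k where k: "n = k * (k + 1) div 2" unfolding triangular_def by blast
  have "even (k * (k + 1))" by simp
  then have "2 * n = k * (k + 1)" using k by simp
  then have "8 * n + 1 = (2 * k + 1) ^ 2" by (simp add: power2_eq_square algebra_simps)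
  then show "\<exists>s. 8 * n + 1 = s ^ 2" ..
next
  assume "\<exists>s. 8 * n + 1 = s ^ 2"
  then obtain s where s: "8 * n + 1 = s ^ 2" by blast
  then have "odd (s ^ 2)" by (metis even_add even_mult_iff even_numeral odd_one dvd_def)
  then have "odd s" by simp
  then obtain k where "s = 2 * k + 1" by (elim oddE)
  then have "2 * n = k * (k + 1)" using s by (simp add: power2_eq_square algebra_simps)
  then have "n = k * (k + 1) div 2" by simp
  then show "triangular n" unfolding triangular_def by blast
qed

theorem theorem5p5:
  fixes p n \<alpha> :: nat
  assumes "prime p" and "p \<ge> 3"
  shows "(\<not> triangular n \<longrightarrow> [v0 (p ^ (2 * \<alpha>) * 9\<^sup>2 * (32 * n + 4)) = 0] (mod 27)) \<and>
    (\<forall>i \<in> {1..p - 1}.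
      [v0 (p ^ (2 * \<alpha> + 1) * 9\<^sup>2 * (32 * p * n + 32 * i + 4 * p)) = 0] (mod 27)) \<and>
    (\<forall>j::nat. \<not> QuadRes (int p) (8 * int j + 1) \<longrightarrow>
      [v0 (p ^ (2 * \<alpha>) * 9\<^sup>2 * (32 * p * n + 32 * j + 4)) = 0] (mod 27))"
proof (intro conjI impI ballI allI)
  have odd: "odd p" using assms prime_odd_nat[of p] by simp
  {
    assume "\<not> triangular n"
    then have "[v0 (p ^ (2 * \<alpha>) * 9\<^sup>2 * (4 * (8 * n + 1))) = 0] (mod 27)"
      by (intro v0_nonsquare_odd_power odd) (simp_all add: triangular_iff_square)
    moreover have "32 * n + 4 = 4 * (8 * n + 1)" by simp
    ultimately show "[v0 (p ^ (2 * \<alpha>) * 9\<^sup>2 * (32 * n + 4)) = 0] (mod 27)" by (simp only:)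
  next
    fix i assume i: "i \<in> {1..p - 1}"
    \<comment> \<open>The odd leftover factor p is merged with the last factor. Then p divides N
      exactly once, as it does not divide 8i, and p^2 = 1 modulo 8 gives the residue class.\<close>
    define N where "N = p * (8 * p * n + 8 * i + p)"
    have "N mod 8 = 1"
    proof -
      obtain k where k: "p = 2 * k + 1" using odd by (elim oddE)
      have "even (k * (k + 1))" by simp
      then obtain l where "k * (k + 1) = 2 * l" by blast
      then have "p * p = 8 * l + 1" by (simp add: k algebra_simps)
      moreover have "N = 8 * (p * (p * n + i)) + p * p" by (simp add: N_def algebra_simps)
      ultimately have "N = 8 * (p * (p * n + i) + l) + 1" by simp
      then show ?thesis by presburger
    qed
    moreover have "\<nexists>s. N = s ^ 2"
    proof
      assume "\<exists>s. N = s ^ 2"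
      then obtain s where s: "N = s ^ 2" by blast
      then have "p dvd s ^ 2" unfolding s[symmetric] N_def by simp
      then have "p dvd s" by (rule prime_dvd_power[OF assms(1)])
      then obtain t where "s = p * t" by blast
      then have "8 * p * n + 8 * i + p = p * t ^ 2"
        using s assms(2) by (simp add: N_def power2_eq_square)
      then have "p dvd p * (8 * n + 1) + 8 * i" by (simp add: algebra_simps)
      then have "p dvd 8 * i" by (simp only: dvd_add_right_iff[OF dvd_triv_left])
      moreover have "coprime p 8"
      proof -
        have "coprime p (2 ^ 3)" using odd by (simp only: coprime_power_right_iff coprime_right_2_iff_odd) simp
        then show ?thesis by simp
      qed
      ultimately have "p dvd i" by (simp add: coprime_dvd_mult_right_iff)
      then show False using i by (auto dest: dvd_imp_le)
    qed
    ultimately have "[v0 (p ^ (2 * \<alpha>) * 9\<^sup>2 * (4 * N)) = 0] (mod 27)"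
      by (rule v0_nonsquare_odd_power[OF odd])
    moreover have "p ^ (2 * \<alpha> + 1) * 9\<^sup>2 * (32 * p * n + 32 * i + 4 * p) = p ^ (2 * \<alpha>) * 9\<^sup>2 * (4 * N)"
      by (simp add: N_def algebra_simps)
    ultimately show "[v0 (p ^ (2 * \<alpha> + 1) * 9\<^sup>2 * (32 * p * n + 32 * i + 4 * p)) = 0] (mod 27)"
      by (simp only:)
  next
    fix j :: nat assume j: "\<not> QuadRes (int p) (8 * int j + 1)"
    \<comment> \<open>N and 8j+1 differ by a multiple of p, so a square N would make 8j+1 a square
      modulo p.\<close>
    define N where "N = 8 * (p * n + j) + 1"
    have "N mod 8 = 1" unfolding N_def by presburger
    moreover have "\<nexists>s. N = s ^ 2"
    proof
      assume "\<exists>s. N = s ^ 2"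
      then obtain s where s: "N = s ^ 2" by blast
      have "(int s)\<^sup>2 = int N" by (simp add: s)
      also have "\<dots> = 8 * int j + 1 + int p * (8 * int n)" by (simp add: N_def algebra_simps)
      finally have "[(int s)\<^sup>2 = 8 * int j + 1] (mod int p)" by (simp add: cong_def)
      then show False using j unfolding QuadRes_def by blast
    qed
    ultimately have "[v0 (p ^ (2 * \<alpha>) * 9\<^sup>2 * (4 * N)) = 0] (mod 27)"
      by (rule v0_nonsquare_odd_power[OF odd])
    moreover have "32 * p * n + 32 * j + 4 = 4 * N" by (simp add: N_def)
    ultimately show "[v0 (p ^ (2 * \<alpha>) * 9\<^sup>2 * (32 * p * n + 32 * j + 4)) = 0] (mod 27)"
      by (simp only:)
  }
qed

end
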